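(* Let $p\ge1$, and let $m_2,\ldots,m_{p-1},r\ge0$ and $m_1,m_p\ge1$ be integers. Put $|\mathbf m|=m_1+\cdots+m_p$. Then $$\begin{aligned}&\sum_{j=1}^p(-1)^{j-1}\zeta(m_p+1,m_{p-1}+1,\ldots,m_{j+1}+1)\,\zeta_B^\star(r+2,\mathbf m_j^\vee)\\ &=\sum_{j=1}^r(-1)^{r-j}\zeta(m_p+1,\ldots,m_1+1,\{1\}_{r-j})\,\zeta_B^\star(j+1)\\ &\quad+(-1)^r2^{|\mathbf m|+1}\log(2)\sum_{\sigma_1,\ldots,\sigma_{p+r}\in\{\pm1\}}\mathrm{Li}_{m_p+1,\ldots,m_1+1,\{1\}_r}\bigl(\sigma_{p+r},\,\sigma_{p+r}\sigma_{p+r-1},\,\sigma_{p+r-1}\sigma_{p+r-2},\ldots,\sigma_2\sigma_1\bigr)\\ &\quad+(-1)^r2^{|\mathbf m|+1}\sum_{\sigma_1,\ldots,\sigma_{p+r}\in\{\pm1\}}\mathrm{Li}_{m_p+1,\ldots,m_1+1,\{1\}_{r+1}}\bigl(\sigma_{p+r},\,\sigma_{p+r}\sigma_{p+r-1},\ldots,\sigma_2\sigma_1,\,-\sigma_1\bigr).\end{aligned}$$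
   Context: $\zeta(k_1,\ldots,k_r)=\sum_{n_1>\cdots>n_r\ge1}\prod n_j^{-k_j}$ ($k_1\ge2$), with $\zeta(\emptyset)=1$ (this occurs for $j=p$ on the left). $\zeta_n^\star(k_1,\ldots,k_r)=\sum_{n\ge n_1\ge\cdots\ge n_r\ge1}\prod n_j^{-k_j}$, $\zeta_n^\star(\emptyset)=1$. The Apéry-type multiple zeta $B$-star value is $$\zeta_B^\star(k_1,\ldots,k_r)=\sum_{n=1}^\infty\frac{\zeta_n^\star(k_2,\ldots,k_r)}{n^{k_1}4^n}\binom{2n}{n}.$$ Multivariable polylogarithm: $\mathrm{Li}_{a_1,\ldots,a_q}(x_1,\ldots,x_q)=\sum_{n_1>\cdots>n_q\ge1}\frac{x_1^{n_1}\cdots x_q^{n_q}}{n_1^{a_1}\cdots n_q^{a_q}}$. In the first polylogarithm sum the argument list consists of $\sigma_{p+r}$ followed by $\sigma_{p+r+1-i}\sigma_{p+r-i}$ for $i=1,\ldots,p+r-1$ (nothing follows if $p+r=1$); in the second, the same list followed by $-\sigma_1$. $\{1\}_d$ is $1$ repeated $d$ times. Put $\mathbf m_j=(m_1,m_2+1,\ldots,m_j+1)$, $\mathbf m_1=(m_1)$. The Hoffman dual of an index (finite sequence of positive integers) $\mathbf a=(a_1,\ldots,a_q)$ is the index $\mathbf a^\vee=(a'_1,\ldots,a'_{q'})$ of the same weight $|\mathbf a|=a_1+\cdots+a_q$ such that $\{1,\ldots,|\mathbf a|-1\}$ is the disjoint union of $\{a_1,a_1+a_2,\ldots,a_1+\cdots+a_{q-1}\}$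 and $\{a'_1,a'_1+a'_2,\ldots,a'_1+\cdots+a'_{q'-1}\}$. *)

theory Defs
  imports "HOL-Analysis.Analysis"
begin

text \<open>
  An index is a list of positive integers.  Sums over all \<open>n\<^sub>1 > \<dots> > n\<^sub>q \<ge> 1\<close> are read as limits,
  as \<open>N\<close> tends to infinity, of the finite sums over \<open>N \<ge> n\<^sub>1 > \<dots> > n\<^sub>q \<ge> 1\<close>.  This covers the
  conditionally convergent cases and, for absolutely convergent sums, agrees with the
  unconditional sum.  For the empty index, the only tuple is the empty one, so the values are \<open>1\<close>.
\<close>

definition decreasing_tuples :: "nat \<Rightarrow> nat \<Rightarrow> nat list set" where
  "decreasing_tuples N q =
     {ns. length ns = q \<and> sorted_wrt (>) ns \<and> set ns \<subseteq> {1..N}}"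

definition weakly_decreasing_tuples :: "nat \<Rightarrow> nat \<Rightarrow> nat list set" where
  "weakly_decreasing_tuples N q =
     {ns. length ns = q \<and> sorted_wrt (\<ge>) ns \<and> set ns \<subseteq> {1..N}}"

definition multi_zeta :: "nat list \<Rightarrow> real" where
  "multi_zeta k =
     lim (\<lambda>N. \<Sum>ns\<in>decreasing_tuples N (length k).
                \<Prod>i<length k. 1 / real (ns ! i) ^ (k ! i))"

definition multi_zeta_star_trunc :: "nat \<Rightarrow> nat list \<Rightarrow> real" where
  "multi_zeta_star_trunc n k =
     (\<Sum>ns\<in>weakly_decreasing_tuples n (length k).
        \<Prod>i<length k. 1 / real (ns ! i) ^ (k ! i))"

text \<open>
  The index is nonempty, and its first entry is passed separately:
  \<open>zeta_B_star k\<^sub>1 [k\<^sub>2, \<dots>, k\<^sub>r]\<close> is the value at \<open>(k\<^sub>1, \<dots>, k\<^sub>r)\<close>.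
\<close>

definition zeta_B_star :: "nat \<Rightarrow> nat list \<Rightarrow> real" where
  "zeta_B_star k1 ks =
     (\<Sum>i. let n = Suc i in
        multi_zeta_star_trunc n ks / (real n ^ k1 * 4 ^ n) * real ((2 * n) choose n))"

definition multi_polylog :: "nat list \<Rightarrow> 'a::real_normed_field list \<Rightarrow> 'a" where
  "multi_polylog a x =
     lim (\<lambda>N. \<Sum>ns\<in>decreasing_tuples N (length a).
                \<Prod>i<length a. (x ! i) ^ (ns ! i) / of_nat (ns ! i) ^ (a ! i))"

definition proper_partial_sums :: "nat list \<Rightarrow> nat set" where
  "proper_partial_sums a = {sum_list (take i a) | i. 1 \<le> i \<and> i < length a}"

definition hoffman_dual :: "nat list \<Rightarrow> nat list" where
  "hoffman_dual a =
     (THE b. (\<forall>k\<in>set b. 1 \<le> k) \<and> sum_list b = sum_list a \<and>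
        proper_partial_sums a \<union> proper_partial_sums b = {1..<sum_list a} \<and>
        proper_partial_sums a \<inter> proper_partial_sums b = {})"

text \<open>\<open>index_m m j\<close> is \<open>(m\<^sub>1, m\<^sub>2 + 1, \<dots>, m\<^sub>j + 1)\<close>.\<close>

definition index_m :: "(nat \<Rightarrow> nat) \<Rightarrow> nat \<Rightarrow> nat list" where
  "index_m m j = m 1 # map (\<lambda>i. m i + 1) [2..<j + 1]"

text \<open>\<open>index_desc m p j\<close> is \<open>(m\<^sub>p + 1, m\<^sub>p\<^sub>-\<^sub>1 + 1, \<dots>, m\<^sub>j + 1)\<close>, which is empty for \<open>j = p + 1\<close>.\<close>

definition index_desc :: "(nat \<Rightarrow> nat) \<Rightarrow> nat \<Rightarrow> nat \<Rightarrow> nat list" where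
  "index_desc m p j = rev (map (\<lambda>i. m i + 1) [j..<p + 1])"

text \<open>
  \<open>sigma_args \<sigma> q\<close> is \<open>(\<sigma>\<^sub>q, \<sigma>\<^sub>q \<sigma>\<^sub>q\<^sub>-\<^sub>1, \<dots>, \<sigma>\<^sub>2 \<sigma>\<^sub>1)\<close>, a list of length \<open>q\<close> for \<open>q \<ge> 1\<close>.
\<close>

definition sigma_args :: "(nat \<Rightarrow> 'a::real_normed_field) \<Rightarrow> nat \<Rightarrow> 'a list" where
  "sigma_args \<sigma> q = \<sigma> q # map (\<lambda>i. \<sigma> (q + 1 - i) * \<sigma> (q - i)) [1..<q]"

end

theory Submission
  imports Defs
begin

text \<open>
  Let \<open>Z(z)\<close> be the sum of \<open>\<Prod>(n\<^sub>i + z)\<^bsup>-b\<^sub>i\<^esup>\<close> over \<open>1 \<le> n\<^sub>1 < \<dots> < n\<^sub>q\<close>, where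
  \<open>b = ({1}\<^sub>r\<^sub>+\<^sub>1, m\<^sub>1 + 1, \<dots>, m\<^sub>p + 1)\<close>.  Its alternating differences at integers are nonnegative, and
  \<open>Z(-1/2)\<close> equals its Newton series at \<open>0\<close>, whose weights are \<open>binom(2n, n) / 4\<^sup>n\<close>.  At integers the
  antipode relation writes \<open>Z\<close> as a combination of star sums with multiple zeta coefficients, and
  binomial duality turns the differences of a star sum into a star sum of the Hoffman dual index.
  So the Newton series is a combination of Apery-type values; the contribution of \<open>n\<^bsup>-1\<^esup>\<close> is
  \<open>2 log 2\<close>.  On the other side, summing over the signs \<open>\<sigma>\<close> selects tuples of equal parity: the even
  ones give multiple zeta values and the odd ones give \<open>Z(-1/2)\<close>.
\<close>

section \<open>Newton series at half-integers\<close>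

text \<open>The point -1/2 comes from parity: an odd \<open>n = 2 * k - 1\<close> is twice
  \<open>k - 1 / 2\<close>, an even \<open>n = 2 * k\<close> is twice \<open>k\<close>. The obstacle
  is that integer values do not determine a function at -1/2, so the Newton series needs a
  justification of its own. It is obtained by induction along the construction of \<open>Z\<close>,
  which alternates division by a power of \<open>x\<close> with summation over
  \<open>x + 1, x + 2, ...\<close>. The property carried along joins validity of the series with
  nonnegativity of all alternating differences: nonnegativity supplies convergence in the division
  step and the exchange of sums in the summation step. Division requires base points
  \<open>k >= 1\<close>; summation, starting at \<open>x + 1\<close>, brings the base point back
  down to 0. The leading ones of \<open>b\<close> produce the exponents: under duality each becomes
  a factor \<open>1 / n\<close>, so prefixes made of ones give the values with empty star part and
  exponents \<open>1, ..., r + 1\<close>, and every longer prefix gives exponent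
  \<open>r + 2\<close>. The exponent 1 is the source of the logarithm.\<close>

lemma tannery_sequentially:
  fixes a :: "nat \<Rightarrow> nat \<Rightarrow> real"
  assumes "\<And>k. (\<lambda>n. a k n) \<longlonglongrightarrow> b k" "\<And>k n. \<bar>a k n\<bar> \<le> M k" "summable M"
  shows "(\<lambda>n. \<Sum>k. a k n) \<longlonglongrightarrow> (\<Sum>k. b k)"
proof -
  have "eventually (\<lambda>(k, n). norm (a k n) \<le> M k) (at_top \<times>\<^sub>F sequentially)"
    using assms(2) by (intro always_eventually) auto
  from tannerys_theorem[OF assms(1) this assms(3)] show ?thesis by simp
qed

lemma sums_suminf_swap:
  fixes f :: "nat \<Rightarrow> nat \<Rightarrow> real"
  assumes nonneg: "\<And>j n. 0 \<le> f j n" and rows: "\<And>j. f j sums g j" and "summable g"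
  shows "(\<lambda>n. \<Sum>j. f j n) sums (\<Sum>j. g j)"
proof -
  have le: "(\<Sum>n<N. f j n) \<le> g j" for j N
    using sum_le_suminf[of "f j" "{..<N}"] rows[of j] nonneg by (auto simp: sums_iff)
  have col: "summable (\<lambda>j. f j n)" for n
  proof (rule summable_comparison_test'[OF \<open>summable g\<close>, of 0])
    show "norm (f j n) \<le> g j" for j
      using sum_le_suminf[of "f j" "{n}"] rows[of j] nonneg by (auto simp: sums_iff)
  qed
  have "(\<lambda>N. \<Sum>j. \<Sum>n<N. f j n) \<longlonglongrightarrow> (\<Sum>j. g j)"
  proof (rule tannery_sequentially[OF _ _ \<open>summable g\<close>])
    show "(\<lambda>N. \<Sum>n<N. f j n) \<longlonglongrightarrow> g j" for j
      using rows[of j] by (simp add: sums_def)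
    show "\<bar>\<Sum>n<N. f j n\<bar> \<le> g j" for j N
      using le nonneg by (simp add: sum_nonneg)
  qed
  then show ?thesis
    by (simp add: sums_def suminf_sum[OF col])
qed

section \<open>Central binomial weights\<close>

definition central_weight :: "nat \<Rightarrow> real" where
  "central_weight n = real ((2 * n) choose n) / 4 ^ n"

lemma central_weight_0 [simp]: "central_weight 0 = 1"
  by (simp add: central_weight_def)

lemma central_weight_pos: "central_weight n > 0"
  by (simp add: central_weight_def)

text \<open>The ratio of consecutive weights is what makes the Abel summation in
  \<open>newton_rep_divide\<close> close up; it also drives the bound
  \<open>central_weight_le\<close>.\<close>

lemma central_weight_Suc:
  "2 * (real n + 1) * central_weight (Suc n) = (2 * real n + 1) * central_weight n"
proof -
  have a: "Suc n * (Suc (2 * n) choose Suc n) = Suc (2 * n) * ((2 * n) choose n)"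
    by (rule Suc_times_binomial)
  have "Suc (2 * n) choose n = Suc (2 * n) choose Suc n"
    using binomial_symmetric[of n "Suc (2 * n)"] by simp
  then have b: "(2 * Suc n) choose Suc n = 2 * (Suc (2 * n) choose Suc n)"
    by simp
  define B C where "B = real ((2 * n) choose n)" and "C = real (Suc (2 * n) choose Suc n)"
  have "real (Suc n) * C = real (Suc (2 * n)) * B"
    unfolding B_def C_def by (rule arg_cong[OF a, of real, unfolded of_nat_mult])
  moreover have eqs: "central_weight (Suc n) = C / (2 * 4 ^ n)" "central_weight n = B / 4 ^ n"
    unfolding central_weight_def b B_def C_def by (simp_all add: field_simps)
  ultimately have "(real (Suc n) * C) / 4 ^ n = real (Suc (2 * n)) * B / 4 ^ n" by simp
  moreover have "2 * (real n + 1) * (C / (2 * 4 ^ n)) = (real (Suc n) * C) / 4 ^ n"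
    by (simp add: field_simps)
  moreover have "(2 * real n + 1) * (B / 4 ^ n) = real (Suc (2 * n)) * B / 4 ^ n"
    by (simp add: field_simps)
  ultimately show ?thesis
    unfolding eqs by (simp only:)
qed

lemma central_weight_le: "central_weight n \<le> 1 / sqrt (2 * real n + 1)"
proof (induction n)
  case (Suc n)
  have "central_weight (Suc n) = (2 * real n + 1) / (2 * (real n + 1)) * central_weight n"
    using central_weight_Suc[of n] by (simp add: field_simps)
  also have "\<dots> \<le> (2 * real n + 1) / (2 * (real n + 1)) * (1 / sqrt (2 * real n + 1))"
    using Suc by (intro mult_left_mono) auto
  also have "\<dots> \<le> 1 / sqrt (2 * real (Suc n) + 1)"
  proof -
    define s t where "s = sqrt (2 * real n + 1)" and "t = sqrt (2 * real (Suc n) + 1)"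
    have st: "s > 0" "t > 0" "s * s = 2 * real n + 1" "t * t = 2 * real n + 3"
      by (auto simp: s_def t_def)
    have "s * t = sqrt ((2 * real n + 1) * (2 * real n + 3))"
      by (simp add: s_def t_def real_sqrt_mult add_ac)
    \<comment> \<open>The product \<open>(2 * n + 1) * (2 * n + 3)\<close> is
      \<open>(2 * n + 2) ^ 2 - 1\<close>.\<close>
    also have "\<dots> \<le> sqrt ((2 * (real n + 1)) ^ 2)"
      by (intro real_sqrt_le_mono) (simp add: power2_eq_square algebra_simps)
    finally have "s * t \<le> 2 * (real n + 1)" by simp
    moreover have "(2 * real n + 1) / (2 * (real n + 1)) * (1 / s) = s / (2 * (real n + 1))"
      unfolding st(3)[symmetric] using st(1) by simp
    moreover have "s / (2 * (real n + 1)) \<le> 1 / t"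
      using \<open>s * t \<le> 2 * (real n + 1)\<close> st(1,2) by (simp add: field_simps)
    ultimately have "(2 * real n + 1) / (2 * (real n + 1)) * (1 / s) \<le> 1 / t"
      by (simp only:)
    then show ?thesis by (simp add: s_def t_def)
  qed
  finally show ?case .
qed simp

text \<open>\<open>alt_diff h n k\<close> is \<open>(-1)\<^sup>n\<close> times the \<open>n\<close>-th forward difference of \<open>h\<close> at \<open>k\<close>.\<close>

fun alt_diff :: "(nat \<Rightarrow> real) \<Rightarrow> nat \<Rightarrow> nat \<Rightarrow> real" where
  "alt_diff h 0 k = h k"
| "alt_diff h (Suc n) k = alt_diff h n k - alt_diff h n (Suc k)"

lemma alt_diff_const: "alt_diff (\<lambda>i. c) n k = (if n = 0 then c else 0)"
  by (induction n arbitrary: k) auto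

lemma alt_diff_cmult: "alt_diff (\<lambda>i. c * h i) n k = c * alt_diff h n k"
  by (induction n arbitrary: k) (auto simp: algebra_simps)

lemma alt_diff_sum: "alt_diff (\<lambda>i. \<Sum>j\<in>A. h j i) n k = (\<Sum>j\<in>A. alt_diff (h j) n k)"
  by (induction n arbitrary: k) (auto simp: sum_subtractf)

text \<open>Leibniz rule for the product of \<open>i\<close> and \<open>h i / i\<close>: the factor
  \<open>i\<close> has constant first difference, so only two terms survive. The condition on
  \<open>k\<close> keeps out the point 0, where the quotient is 0 by convention.\<close>

lemma alt_diff_divide:
  assumes "k \<ge> 1"
  shows "alt_diff h (Suc n) k = real (Suc n + k) * alt_diff (\<lambda>i. h i / real i) (Suc n) k
    - real (Suc n) * alt_diff (\<lambda>i. h i / real i) n k"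
  using assms
proof (induction n arbitrary: k)
  case 0
  define a b where "a = h k / real k" and "b = h (Suc k) / real (Suc k)"
  have "h k = real k * a" "h (Suc k) = real (Suc k) * b"
    using 0 by (simp_all add: a_def b_def)
  then have "h k - h (Suc k) = real (Suc 0 + k) * (a - b) - real (Suc 0) * a"
    by (simp add: algebra_simps)
  then show ?case by (simp add: a_def b_def)
next
  case (Suc n)
  define u where "u = alt_diff (\<lambda>i. h i / real i)"
  have s: "u (Suc m) l = u m l - u m (Suc l)" for m l
    by (simp add: u_def)
  have "alt_diff h (Suc (Suc n)) k = alt_diff h (Suc n) k - alt_diff h (Suc n) (Suc k)"
    by simp
  also have "\<dots> = (real (Suc n + k) * u (Suc n) k - real (Suc n) * u n k)
      - (real (Suc n + Suc k) * u (Suc n) (Suc k) - real (Suc n) * u n (Suc k))"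
    using Suc.IH[of k] Suc.IH[of "Suc k"] Suc.prems by (simp only: u_def)
  also have "\<dots> = real (Suc (Suc n) + k) * u (Suc (Suc n)) k - real (Suc (Suc n)) * u (Suc n) k"
    unfolding s[of "Suc n"] s[of n] of_nat_Suc of_nat_add by algebra
  finally show ?case by (simp only: u_def)
qed

text \<open>In binomial coefficients this is absorption,
  \<open>Suc n * binom(n, i) / Suc i = binom(Suc n, Suc i)\<close>; the term for index 0, which the
  left side lacks, accounts for \<open>x 0\<close>. The induction telescopes
  \<open>alt_diff_divide\<close> at 1.\<close>

lemma alt_diff_divide_1:
  "real (Suc n) * alt_diff (\<lambda>i. x i / real i) n 1 = x 0 - alt_diff x (Suc n) 0"
proof (induction n)
  case (Suc n)
  have "alt_diff x (Suc (Suc n)) 0 = alt_diff x (Suc n) 0 - alt_diff x (Suc n) 1"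
    by simp
  with Suc alt_diff_divide[of 1 x n] show ?case by simp
qed simp

text \<open>
  Since \<open>central_weight n\<close> is \<open>(-1)\<^sup>n binom(-1/2, n)\<close>, the series is the Newton expansion of \<open>h\<close> at \<open>k\<close>,
  evaluated at \<open>k - 1/2\<close>.  All its terms are nonnegative, so such expansions may be summed termwise.
\<close>

definition newton_rep :: "(real \<Rightarrow> real) \<Rightarrow> nat \<Rightarrow> bool" where
  "newton_rep h k \<longleftrightarrow> (\<forall>n. alt_diff (\<lambda>i. h (real i)) n k \<ge> 0) \<and>
     (\<lambda>n. central_weight n * alt_diff (\<lambda>i. h (real i)) n k) sums h (real k - 1 / 2)"

lemma newton_rep_1: "newton_rep (\<lambda>x. 1) k"
proof -
  have "(\<lambda>n. central_weight n * alt_diff (\<lambda>i. 1) n k) sums (\<Sum>n\<in>{0}. central_weight n * alt_diff (\<lambda>i. 1) n k)"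
    by (rule sums_finite) (auto simp: alt_diff_const)
  then show ?thesis
    by (auto simp: newton_rep_def alt_diff_const)
qed

text \<open>Abel summation writes the partial sums for \<open>h\<close> as \<open>k - 1 / 2\<close>
  times those for \<open>h x / x\<close> plus a boundary term. Both parts are nonnegative, so the
  new series is bounded and converges; it then remains to see that the boundary term tends to
  0.\<close>

lemma newton_rep_divide:
  assumes "newton_rep h k" "k \<ge> 1"
  shows "newton_rep (\<lambda>x. h x / x) k"
proof -
  define e where "e n = alt_diff (\<lambda>i. h (real i)) n k" for n
  define u where "u n = alt_diff (\<lambda>i. h (real i) / real i) n k" for n
  define w where "w = central_weight"
  have w: "w n > 0" for n by (simp add: w_def central_weight_pos)
  have e_nonneg: "e n \<ge> 0" for n
    using assms(1) by (auto simp: newton_rep_def e_def w_def)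
  have e_sums: "(\<lambda>n. w n * e n) sums h (real k - 1 / 2)"
    using assms(1) by (auto simp: newton_rep_def e_def w_def)
  have e0: "e 0 = real k * u 0"
    using assms(2) by (simp add: e_def u_def)
  have eS: "e (Suc n) = real (Suc n + k) * u (Suc n) - real (Suc n) * u n" for n
    unfolding e_def u_def by (rule alt_diff_divide[OF assms(2)])
  \<comment> \<open>Solved for \<open>u (Suc n)\<close>, the Leibniz recurrence has only nonnegative
    terms.\<close>
  have u_nonneg: "u n \<ge> 0" for n
  proof (induction n)
    case 0
    then show ?case using e0 e_nonneg[of 0] assms(2) by (simp add: zero_le_mult_iff)
  next
    case (Suc n)
    have "real (Suc n + k) * u (Suc n) = e (Suc n) + real (Suc n) * u n"
      using eS[of n] by simp
    also have "\<dots> \<ge> 0" using e_nonneg Suc by (intro add_nonneg_nonneg mult_nonneg_nonneg) auto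
    finally show ?case by (simp add: zero_le_mult_iff)
  qed
  \<comment> \<open>In the step from \<open>N\<close> to \<open>Suc N\<close>, the coefficient of
    \<open>w N * u N\<close> is \<open>(N + k) - (N + 1 / 2)\<close>, by the weight
    recurrence.\<close>
  have abel: "(\<Sum>n\<le>N. w n * e n) = (real k - 1 / 2) * (\<Sum>n<N. w n * u n) + w N * real (N + k) * u N" for N
  proof (induction N)
    case 0
    show ?case using e0 by simp
  next
    case (Suc N)
    have "2 * (real N + 1) * w (Suc N) = (2 * real N + 1) * w N"
      unfolding w_def by (rule central_weight_Suc)
    then have "(real N + 1) * w (Suc N) = (real N + 1 / 2) * w N" by (simp add: field_simps)
    moreover have "(\<Sum>n\<le>Suc N. w n * e n) = (real k - 1 / 2) * (\<Sum>n<N. w n * u n)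
        + w N * real (N + k) * u N + w (Suc N) * (real (Suc N + k) * u (Suc N) - real (Suc N) * u N)"
      using Suc eS[of N] by simp
    ultimately show ?case
      unfolding sum.lessThan_Suc of_nat_Suc of_nat_add by algebra
  qed
  have k2: "real k - 1 / 2 > 0" using assms(2) by linarith
  have e_lim: "(\<lambda>N. \<Sum>n\<le>N. w n * e n) \<longlonglongrightarrow> h (real k - 1 / 2)"
    using e_sums by (simp add: sums_def_le)
  have "summable (\<lambda>n. w n * u n)"
  proof (rule bounded_imp_summable[where B = "h (real k - 1 / 2) / (real k - 1 / 2)"])
    show "w n * u n \<ge> 0" for n using w[of n] u_nonneg[of n] by simp
    show "(\<Sum>n\<le>N. w n * u n) \<le> h (real k - 1 / 2) / (real k - 1 / 2)" for N
    proof -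
      have "(real k - 1 / 2) * (\<Sum>n\<le>N. w n * u n) \<le> (\<Sum>n\<le>Suc N. w n * e n)"
        unfolding abel[of "Suc N"] lessThan_Suc_atMost
        using w[of "Suc N"] u_nonneg[of "Suc N"] by simp
      also have "\<dots> \<le> (\<Sum>n. w n * e n)"
        using e_sums e_nonneg w by (intro sum_le_suminf) (auto simp: sums_iff less_imp_le)
      also have "\<dots> = h (real k - 1 / 2)" using e_sums by (simp add: sums_iff)
      finally show ?thesis using k2 by (simp add: field_simps)
    qed
  qed
  then obtain s where s: "(\<lambda>n. w n * u n) sums s" by (auto simp: summable_def)
  define L where "L = h (real k - 1 / 2) - (real k - 1 / 2) * s"
  have L_lim: "(\<lambda>N. w N * real (N + k) * u N) \<longlonglongrightarrow> L"
  proof -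
    have "(\<lambda>N. (\<Sum>n\<le>N. w n * e n) - (real k - 1 / 2) * (\<Sum>n<N. w n * u n)) \<longlonglongrightarrow> L"
      unfolding L_def using s by (intro tendsto_intros e_lim) (simp add: sums_def)
    then show ?thesis by (simp add: abel)
  qed
  have "L \<ge> 0"
    by (rule LIMSEQ_le_const[OF L_lim]) (use w u_nonneg in \<open>auto simp: less_imp_le\<close>)
  \<comment> \<open>A positive limit would give \<open>w n * u n \<ge> c / n\<close> eventually, against summability.\<close>
  have "L = 0"
  proof (rule ccontr)
    assume "L \<noteq> 0"
    then have "L > 0" using \<open>L \<ge> 0\<close> by simp
    then have "eventually (\<lambda>N. w N * real (N + k) * u N > L / 2) sequentially"
      by (intro order_tendstoD(1)[OF L_lim]) auto
    then obtain N0 where N0: "\<And>N. N \<ge> N0 \<Longrightarrow> w N * real (N + k) * u N > L / 2"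
      by (auto simp: eventually_sequentially)
    have "summable (\<lambda>n. inverse (real (n + k)))"
    proof (rule summable_comparison_test'[of "\<lambda>n. 2 / L * (w n * u n)" N0])
      show "summable (\<lambda>n. 2 / L * (w n * u n))"
        using s by (intro summable_mult) (auto simp: sums_iff)
      show "norm (inverse (real (n + k))) \<le> 2 / L * (w n * u n)" if "n \<ge> N0" for n
        using N0[OF that] \<open>L > 0\<close> assms(2) by (simp add: field_simps)
    qed
    then have "summable (\<lambda>n. inverse (real n))"
      by (subst (asm) summable_iff_shift)
    then show False using not_summable_harmonic[where 'a = real] by simp
  qed
  then have "s = h (real k - 1 / 2) / (real k - 1 / 2)"
    using k2 by (simp add: L_def field_simps)
  then show ?thesis
    using s u_nonneg by (simp add: newton_rep_def u_def w_def)
qed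

lemma newton_rep_divide_power:
  assumes "newton_rep h k" "k \<ge> 1"
  shows "newton_rep (\<lambda>x. h x / x ^ b) k"
proof (induction b)
  case (Suc b)
  then show ?case using newton_rep_divide[OF Suc assms(2)] by (simp add: mult.commute)
qed (use assms in simp)

text \<open>Each summand is expanded at its own base point \<open>k + 1 + j\<close>, and
  nonnegativity permits the exchange of the two sums. Only base points above \<open>k\<close> occur,
  so \<open>h\<close> may contain a division by \<open>x\<close> even when
  \<open>k = 0\<close>.\<close>

lemma newton_rep_suminf:
  assumes rep: "\<And>j. j > k \<Longrightarrow> newton_rep h j"
    and summ: "\<And>i. i \<ge> k \<Longrightarrow> summable (\<lambda>j. h (real i + 1 + real j))"
      "summable (\<lambda>j. h (real k - 1 / 2 + 1 + real j))"
  shows "newton_rep (\<lambda>x. \<Sum>j. h (x + 1 + real j)) k"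
proof -
  define e where "e = alt_diff (\<lambda>i. h (real i))"
  have sums: "(\<lambda>j. e n (i + 1 + j)) sums alt_diff (\<lambda>i. \<Sum>j. h (real i + 1 + real j)) n i"
    if "i \<ge> k" for n i
    using that
  proof (induction n arbitrary: i)
    case 0
    then show ?case using summ(1)[of i] by (simp add: e_def summable_sums add_ac)
  next
    case (Suc n)
    have "(\<lambda>j. e n (i + 1 + j) - e n (Suc i + 1 + j)) sums
        (alt_diff (\<lambda>i. \<Sum>j. h (real i + 1 + real j)) n i - alt_diff (\<lambda>i. \<Sum>j. h (real i + 1 + real j)) n (Suc i))"
      using Suc by (intro sums_diff Suc.IH) auto
    then show ?case by (simp add: e_def)
  qed
  have nonneg: "e n j \<ge> 0" if "j > k" for n j
    using rep[OF that] by (simp add: newton_rep_def e_def)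
  have "(\<lambda>n. \<Sum>j. central_weight n * e n (k + 1 + j)) sums (\<Sum>j. h (real k - 1 / 2 + 1 + real j))"
  proof (rule sums_suminf_swap[OF _ _ summ(2)])
    show "0 \<le> central_weight n * e n (k + 1 + j)" for n j
      using nonneg[of "k + 1 + j" n] central_weight_pos[of n] by simp
    have eq: "real (k + 1 + j) - 1 / 2 = real k - 1 / 2 + 1 + real j" for j by simp
    show "(\<lambda>n. central_weight n * e n (k + 1 + j)) sums h (real k - 1 / 2 + 1 + real j)" for j
      using rep[of "k + 1 + j"] unfolding newton_rep_def eq e_def by simp
  qed
  moreover have "(\<Sum>j. central_weight n * e n (k + 1 + j)) =
      central_weight n * alt_diff (\<lambda>i. \<Sum>j. h (real i + 1 + real j)) n k" for n
    using sums_mult[OF sums[of k n], of "central_weight n"] by (simp add: sums_iff)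
  moreover have "alt_diff (\<lambda>i. \<Sum>j. h (real i + 1 + real j)) n k \<ge> 0" for n
    using sums_le[OF _ sums_zero sums[of k n]] nonneg by simp
  ultimately show ?thesis by (simp add: newton_rep_def)
qed

section \<open>Nested sums\<close>

text \<open>
  \<open>tail_zeta [b\<^sub>1, \<dots>, b\<^sub>q] z\<close> is the sum of \<open>\<Prod>(n\<^sub>i + z)\<^bsup>-b\<^sub>i\<^esup>\<close> over \<open>1 \<le> n\<^sub>1 < \<dots> < n\<^sub>q\<close>; the
  index is listed in the order opposite to that of \<open>multi_zeta\<close>.
\<close>

fun tail_zeta :: "nat list \<Rightarrow> real \<Rightarrow> real" where
  "tail_zeta [] z = 1"
| "tail_zeta (b # bs) z = (\<Sum>k. tail_zeta bs (z + 1 + real k) / (z + 1 + real k) ^ b)"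

text \<open>The smallest variable is listed first, so \<open>last\<close> is the exponent of the
  largest one, which governs convergence.\<close>

definition admissible :: "nat list \<Rightarrow> bool" where
  "admissible bs \<longleftrightarrow> (\<forall>b\<in>set bs. b \<ge> 1) \<and> (bs \<noteq> [] \<longrightarrow> last bs \<ge> 2)"

lemma admissible_Nil [simp]: "admissible []"
  by (simp add: admissible_def)

lemma admissible_Cons: "admissible (b # bs) \<Longrightarrow> b \<ge> 1 \<and> admissible bs \<and> (bs = [] \<longrightarrow> b \<ge> 2)"
  by (auto simp: admissible_def)

lemma sums_inverse_consecutive:
  assumes "x > (0 :: real)"
  shows "(\<lambda>k. 1 / ((x + real k) * (x + real k + 1))) sums (1 / x)"
proof -
  have "(\<lambda>k. inverse (x + real k)) \<longlonglongrightarrow> 0"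
    by (rule tendsto_inverse_0_at_top, rule filterlim_tendsto_add_at_top[OF tendsto_const])
       (rule filterlim_real_sequentially)
  from telescope_sums'[OF this]
  have "(\<lambda>k. inverse (x + real k) - inverse (x + real (Suc k))) sums inverse x"
    by simp
  moreover have "inverse (x + real k) - inverse (x + real (Suc k)) = 1 / ((x + real k) * (x + real k + 1))" for k
  proof -
    have "x + real k > 0" using assms by simp
    then show ?thesis by (simp add: field_simps)
  qed
  ultimately show ?thesis by (simp add: inverse_eq_divide)
qed

lemma inverse_power_le:
  assumes "x \<ge> (1 / 2 :: real)"
  shows "1 / x ^ (b + c) \<le> 2 ^ c * (1 / x ^ b)"
proof -
  have "1 \<le> (2 * x) ^ c" using assms by (intro one_le_power) simp
  then have "1 \<le> 2 ^ c * x ^ c" by (simp add: power_mult_distrib)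
  then show ?thesis using assms by (simp add: field_simps power_add)
qed

text \<open>The majorant is chosen to telescope: summed over \<open>x + 1, x + 2, ...\<close> it
  leaves \<open>1 / (x + 1)\<close>, and one further division by \<open>x\<close> restores it. Hence
  exponent 1 is enough everywhere but at the last entry. The range \<open>x >= 1 / 2\<close> covers
  all arguments that occur for \<open>z >= - 1 / 2\<close>.\<close>

lemma tail_zeta_term_bound:
  assumes "admissible (b # bs)"
  shows "\<exists>C. \<forall>x\<ge>1/2. 0 \<le> tail_zeta bs x / x ^ b \<and> tail_zeta bs x / x ^ b \<le> C * (1 / (x * (x + 1)))"
  using assms
proof (induction bs arbitrary: b)
  case Nil
  then have "b \<ge> 2" by (auto dest: admissible_Cons)
  then obtain c where c: "b = 2 + c" using le_Suc_ex by blast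
  show ?case
  proof (intro exI[of _ "2 ^ c * 3"] allI impI conjI)
    fix x :: real assume x: "1 / 2 \<le> x"
    show "0 \<le> tail_zeta [] x / x ^ b" using x by simp
    have "1 / x ^ b \<le> 2 ^ c * (1 / x ^ 2)" unfolding c by (rule inverse_power_le[OF x])
    also have "1 / x ^ 2 \<le> 3 * (1 / (x * (x + 1)))"
    proof -
      \<comment> \<open>The constant 3 comes from \<open>x + 1 <= 3 * x\<close> for
        \<open>x >= 1 / 2\<close>.\<close>
      have "x * (x + 1) \<le> x * (3 * x)" using x by (intro mult_left_mono) auto
      then have "3 / (3 * x ^ 2) \<le> 3 / (x * (x + 1))"
        using x by (intro divide_left_mono) (auto simp: power2_eq_square mult_ac)
      then show ?thesis by simp
    qed
    finally show "tail_zeta [] x / x ^ b \<le> 2 ^ c * 3 * (1 / (x * (x + 1)))" by simp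
  qed
next
  case (Cons a bs)
  from Cons.prems have adm: "b \<ge> 1" "admissible (a # bs)" by (auto dest: admissible_Cons)
  then obtain c where c: "b = 1 + c" using le_Suc_ex by blast
  from Cons.IH[OF adm(2)] obtain C where C:
    "\<And>x. x \<ge> 1/2 \<Longrightarrow> 0 \<le> tail_zeta bs x / x ^ a"
    "\<And>x. x \<ge> 1/2 \<Longrightarrow> tail_zeta bs x / x ^ a \<le> C * (1 / (x * (x + 1)))"
    by blast
  show ?case
  proof (intro exI[of _ "2 ^ c * C"] allI impI)
    fix x :: real assume x: "1 / 2 \<le> x"
    have s: "(\<lambda>k. C * (1 / ((x + 1 + real k) * (x + 1 + real k + 1)))) sums (C * (1 / (x + 1)))"
      using x by (intro sums_mult sums_inverse_consecutive) simp
    have nonneg: "0 \<le> tail_zeta bs (x + 1 + real k) / (x + 1 + real k) ^ a" for k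
      using x by (intro C(1)) simp
    have le: "tail_zeta bs (x + 1 + real k) / (x + 1 + real k) ^ a
        \<le> C * (1 / ((x + 1 + real k) * (x + 1 + real k + 1)))" for k
      using x by (intro C(2)) simp
    have summ: "summable (\<lambda>k. tail_zeta bs (x + 1 + real k) / (x + 1 + real k) ^ a)"
    proof (rule summable_comparison_test'[OF sums_summable[OF s], of 0])
      show "norm (tail_zeta bs (x + 1 + real k) / (x + 1 + real k) ^ a)
          \<le> C * (1 / ((x + 1 + real k) * (x + 1 + real k + 1)))" for k
        using nonneg[of k] le[of k] by (simp only: real_norm_def abs_of_nonneg)
    qed
    have 1: "tail_zeta (a # bs) x \<le> C * (1 / (x + 1))"
      using suminf_le[OF le summ sums_summable[OF s]] sums_unique[OF s] by simp
    have 0: "tail_zeta (a # bs) x \<ge> 0"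
      using suminf_nonneg[OF summ nonneg] by simp
    have "C * (1 / (x + 1)) \<ge> 0" using 0 1 by linarith
    have "tail_zeta (a # bs) x / x ^ b \<le> (C * (1 / (x + 1))) * (1 / x ^ b)"
      using mult_right_mono[OF 1, of "1 / x ^ b"] x by (simp del: tail_zeta.simps)
    also have "\<dots> \<le> (C * (1 / (x + 1))) * (2 ^ c * (1 / x ^ 1))"
      unfolding c using \<open>C * (1 / (x + 1)) \<ge> 0\<close> by (intro mult_left_mono inverse_power_le[OF x])
    finally have "tail_zeta (a # bs) x / x ^ b \<le> 2 ^ c * C * (1 / (x * (x + 1)))"
      by (simp add: mult_ac)
    then show "0 \<le> tail_zeta (a # bs) x / x ^ b \<and> tail_zeta (a # bs) x / x ^ b \<le> 2 ^ c * C * (1 / (x * (x + 1)))"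
      using 0 x by simp
  qed
qed

lemma tail_zeta_summable:
  assumes "admissible (b # bs)" "z \<ge> - 1 / 2"
  shows "summable (\<lambda>k. tail_zeta bs (z + 1 + real k) / (z + 1 + real k) ^ b)"
proof -
  from tail_zeta_term_bound[OF assms(1)] obtain C where C:
    "\<And>x. x \<ge> 1/2 \<Longrightarrow> 0 \<le> tail_zeta bs x / x ^ b"
    "\<And>x. x \<ge> 1/2 \<Longrightarrow> tail_zeta bs x / x ^ b \<le> C * (1 / (x * (x + 1)))"
    by blast
  have s: "summable (\<lambda>k. C * (1 / ((z + 1 + real k) * (z + 1 + real k + 1))))"
    using assms(2) by (intro summable_mult sums_summable[OF sums_inverse_consecutive]) simp
  show ?thesis
  proof (rule summable_comparison_test'[OF s, of 0])
    fix k :: nat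
    have "z + 1 + real k \<ge> 1 / 2" using assms(2) by simp
    then show "norm (tail_zeta bs (z + 1 + real k) / (z + 1 + real k) ^ b)
        \<le> C * (1 / ((z + 1 + real k) * (z + 1 + real k + 1)))"
      using C[of "z + 1 + real k"] by simp
  qed
qed

text \<open>Each entry of the index costs division steps at base points above \<open>k\<close> and
  one summation step, so the induction must run over all \<open>k\<close> at once.\<close>

lemma newton_rep_tail_zeta: "admissible bs \<Longrightarrow> newton_rep (tail_zeta bs) k"
proof (induction bs arbitrary: k)
  case Nil
  have "tail_zeta [] = (\<lambda>x. 1)" by auto
  then show ?case using newton_rep_1 by simp
next
  case (Cons b bs k)
  have "newton_rep (\<lambda>z. \<Sum>j. tail_zeta bs (z + 1 + real j) / (z + 1 + real j) ^ b) k"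
    using Cons tail_zeta_summable[OF Cons.prems, of "real _"]
      tail_zeta_summable[OF Cons.prems, of "real k - 1 / 2"]
    by (intro newton_rep_suminf[where h = "\<lambda>x. tail_zeta bs x / x ^ b"] newton_rep_divide_power)
       (auto dest: admissible_Cons)
  moreover have "tail_zeta (b # bs) = (\<lambda>z. \<Sum>j. tail_zeta bs (z + 1 + real j) / (z + 1 + real j) ^ b)"
    by auto
  ultimately show ?case by simp
qed

section \<open>Truncated nested sums and their limits\<close>

fun nested_sum :: "nat \<Rightarrow> nat \<Rightarrow> (nat \<Rightarrow> 'a :: comm_ring_1) list \<Rightarrow> 'a" where
  "nested_sum i N [] = 1"
| "nested_sum i N (f # fs) = (\<Sum>n\<in>{i<..N}. f n * nested_sum i (n - 1) fs)"

lemma decreasing_tuples_0: "decreasing_tuples N 0 = {[]}"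
  by (auto simp: decreasing_tuples_def)

lemma decreasing_tuples_Suc:
  "decreasing_tuples N (Suc q) = (\<lambda>(n, ns). n # ns) ` (SIGMA n:{0<..N}. decreasing_tuples (n - 1) q)"
  unfolding decreasing_tuples_def image_def by (fastforce simp: length_Suc_conv)

lemma finite_decreasing_tuples: "finite (decreasing_tuples N q)"
  by (induction q arbitrary: N) (auto simp: decreasing_tuples_0 decreasing_tuples_Suc)

lemma sum_decreasing_tuples_Suc:
  "sum g (decreasing_tuples N (Suc q)) = (\<Sum>n\<in>{0<..N}. \<Sum>ns\<in>decreasing_tuples (n - 1) q. g (n # ns))"
proof -
  have "inj_on (\<lambda>(n, ns). n # ns) A" for A :: "(nat \<times> nat list) set"
    by (auto simp: inj_on_def)
  then have "sum g (decreasing_tuples N (Suc q)) =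
      (\<Sum>(n, ns)\<in>(SIGMA n:{0<..N}. decreasing_tuples (n - 1) q). g (n # ns))"
    unfolding decreasing_tuples_Suc by (subst sum.reindex) (auto simp: case_prod_unfold)
  then show ?thesis
    by (simp add: sum.Sigma finite_decreasing_tuples)
qed

lemma sum_decreasing_tuples:
  "(\<Sum>ns\<in>decreasing_tuples N (length fs). \<Prod>i<length fs. (fs ! i) (ns ! i)) = nested_sum 0 N fs"
proof (induction fs arbitrary: N)
  case (Cons f fs)
  then show ?case
    by (simp add: sum_decreasing_tuples_Suc prod.lessThan_Suc_shift sum_distrib_left[symmetric]
        del: prod.lessThan_Suc)
qed (simp add: decreasing_tuples_0)

fun star_zeta :: "nat list \<Rightarrow> nat \<Rightarrow> real" where
  "star_zeta [] N = 1"
| "star_zeta (k # ks) N = (\<Sum>n = 1..N. star_zeta ks n / real n ^ k)"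

lemma weakly_decreasing_tuples_0: "weakly_decreasing_tuples N 0 = {[]}"
  by (auto simp: weakly_decreasing_tuples_def)

lemma weakly_decreasing_tuples_Suc:
  "weakly_decreasing_tuples N (Suc q) = (\<lambda>(n, ns). n # ns) ` (SIGMA n:{1..N}. weakly_decreasing_tuples n q)"
  unfolding weakly_decreasing_tuples_def image_def by (fastforce simp: length_Suc_conv)

lemma finite_weakly_decreasing_tuples: "finite (weakly_decreasing_tuples N q)"
  by (induction q arbitrary: N) (auto simp: weakly_decreasing_tuples_0 weakly_decreasing_tuples_Suc)

lemma sum_weakly_decreasing_tuples_Suc:
  "sum g (weakly_decreasing_tuples N (Suc q)) = (\<Sum>n\<in>{1..N}. \<Sum>ns\<in>weakly_decreasing_tuples n q. g (n # ns))"
proof -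
  have "inj_on (\<lambda>(n, ns). n # ns) A" for A :: "(nat \<times> nat list) set"
    by (auto simp: inj_on_def)
  then have "sum g (weakly_decreasing_tuples N (Suc q)) =
      (\<Sum>(n, ns)\<in>(SIGMA n:{1..N}. weakly_decreasing_tuples n q). g (n # ns))"
    unfolding weakly_decreasing_tuples_Suc by (subst sum.reindex) (auto simp: case_prod_unfold)
  then show ?thesis
    by (simp add: sum.Sigma finite_weakly_decreasing_tuples)
qed

lemma multi_zeta_star_trunc_eq: "multi_zeta_star_trunc N ks = star_zeta ks N"
  unfolding multi_zeta_star_trunc_def
proof (induction ks arbitrary: N)
  case (Cons k ks)
  then show ?case
    by (simp add: sum_weakly_decreasing_tuples_Suc prod.lessThan_Suc_shift sum_divide_distrib[symmetric]
        del: prod.lessThan_Suc)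
qed (simp add: weakly_decreasing_tuples_0)

text \<open>\<open>nested_sum\<close> recurses on the largest variable, \<open>tail_zeta\<close> on
  the smallest. Exchanging the sums exposes the smallest variable, so that the two can be
  compared.\<close>

lemma nested_sum_snoc:
  "nested_sum i N (fs @ [g]) = (\<Sum>k\<in>{i<..N}. g k * nested_sum k N fs)"
proof (induction fs arbitrary: N)
  case (Cons f fs)
  have "nested_sum i N ((f # fs) @ [g]) =
      (\<Sum>n\<in>{i<..N}. \<Sum>k\<in>{k\<in>{i<..N}. k < n}. f n * (g k * nested_sum k (n - 1) fs))"
    unfolding append_Cons nested_sum.simps Cons.IH sum_distrib_left
    by (intro sum.cong) auto
  also have "\<dots> = (\<Sum>k\<in>{i<..N}. \<Sum>n\<in>{n\<in>{i<..N}. k < n}. f n * (g k * nested_sum k (n - 1) fs))"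
    by (rule sum.swap_restrict) auto
  also have "\<dots> = (\<Sum>k\<in>{i<..N}. g k * nested_sum k N (f # fs))"
    unfolding nested_sum.simps sum_distrib_left
    by (intro sum.cong) (auto simp: mult_ac)
  finally show ?case .
qed simp

lemma nested_sum_mono:
  fixes fs :: "(nat \<Rightarrow> real) list"
  assumes "\<And>f n. f \<in> set fs \<Longrightarrow> n > i \<Longrightarrow> f n \<ge> 0" "M \<le> N"
  shows "0 \<le> nested_sum i M fs \<and> nested_sum i M fs \<le> nested_sum i N fs"
  using assms
proof (induction fs arbitrary: M N)
  case (Cons f fs)
  have nn: "0 \<le> nested_sum i n fs" for n
    using Cons.IH[of n n] Cons.prems by simp
  show ?case
    unfolding nested_sum.simps using Cons.prems nn
    by (intro conjI sum_nonneg sum_mono2) auto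
qed simp

text \<open>Tannery's theorem applied to the smallest variable: the inner sums increase with
  \<open>N\<close>, so each is dominated by its own limit, and the dominating series is the
  convergent one that defines \<open>tail_zeta\<close>.\<close>

lemma nested_sum_tendsto:
  assumes "admissible bs" "real i + z \<ge> - 1 / 2"
  shows "(\<lambda>N. nested_sum i N (map (\<lambda>a n. 1 / (real n + z) ^ a) (rev bs))) \<longlonglongrightarrow> tail_zeta bs (real i + z)"
  using assms
proof (induction bs arbitrary: i)
  case (Cons b bs)
  define F where "F = (\<lambda>a n. 1 / (real n + z) ^ a)"
  define T where "T k N = nested_sum k N (map F (rev bs))" for k N
  define x where "x j = real i + z + 1 + real j" for j
  have x: "x j \<ge> 1 / 2" and x_eq: "real (i + 1 + j) + z = x j" for j
    using Cons.prems(2) by (simp_all add: x_def)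
  have adm: "admissible bs" using Cons.prems by (auto dest: admissible_Cons)
  have lim: "(\<lambda>N. T (i + 1 + j) N) \<longlonglongrightarrow> tail_zeta bs (x j)" for j
    using Cons.IH[OF adm, of "i + 1 + j"] x[of j] unfolding x_eq T_def F_def by simp
  have mono: "0 \<le> T (i + 1 + j) M \<and> T (i + 1 + j) M \<le> T (i + 1 + j) N" if "M \<le> N" for j M N
    unfolding T_def using Cons.prems(2) that by (intro nested_sum_mono) (auto simp: F_def)
  have le: "T (i + 1 + j) N \<le> tail_zeta bs (x j)" for j N
    using mono by (intro incseq_le[OF _ lim]) (auto simp: incseq_def)
  \<comment> \<open>Extension by 0 turns the sum up to \<open>N\<close> into a series over an index
    set independent of \<open>N\<close>.\<close>
  define a where "a j N = (if i + 1 + j \<le> N then F b (i + 1 + j) * T (i + 1 + j) N else 0)" for j N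
  have F: "F b (i + 1 + j) = 1 / x j ^ b" for j
    using x_eq[of j] by (simp add: F_def)
  have eq: "nested_sum i N (map F (rev (b # bs))) = (\<Sum>j. a j N)" for N
  proof -
    have "(\<Sum>j. a j N) = (\<Sum>j<N - i. a j N)"
      by (rule suminf_finite) (auto simp: a_def)
    also have "\<dots> = (\<Sum>k\<in>{i<..N}. F b k * T k N)"
      by (rule sum.reindex_bij_witness[of _ "\<lambda>k. k - i - 1" "\<lambda>j. i + 1 + j"]) (auto simp: a_def)
    finally show ?thesis by (simp add: nested_sum_snoc T_def)
  qed
  have "(\<lambda>N. \<Sum>j. a j N) \<longlonglongrightarrow> (\<Sum>j. tail_zeta bs (x j) / x j ^ b)"
  proof (rule tannery_sequentially)
    show "(\<lambda>N. a j N) \<longlonglongrightarrow> tail_zeta bs (x j) / x j ^ b" for j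
    proof (rule Lim_transform_eventually)
      show "(\<lambda>N. F b (i + 1 + j) * T (i + 1 + j) N) \<longlonglongrightarrow> tail_zeta bs (x j) / x j ^ b"
        unfolding F using tendsto_mult_left[OF lim[of j], of "1 / x j ^ b"] by simp
      show "eventually (\<lambda>N. F b (i + 1 + j) * T (i + 1 + j) N = a j N) sequentially"
        using eventually_ge_at_top[of "i + 1 + j"] by eventually_elim (simp add: a_def)
    qed
    show "\<bar>a j N\<bar> \<le> tail_zeta bs (x j) / x j ^ b" for j N
    proof -
      have "0 \<le> T (i + 1 + j) N" using mono by blast
      moreover have "0 \<le> tail_zeta bs (x j)" using le[of j N] calculation by linarith
      ultimately show ?thesis
        using le[of j N] x[of j] unfolding a_def F
        by (auto intro!: divide_right_mono)
    qed
    show "summable (\<lambda>j. tail_zeta bs (x j) / x j ^ b)"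
      using tail_zeta_summable[OF Cons.prems] by (simp add: x_def)
  qed
  then show ?case by (simp add: eq[symmetric, unfolded F_def] x_def)
qed simp

lemma nested_sum_abs_le:
  fixes fs gs :: "(nat \<Rightarrow> real) list"
  assumes "list_all2 (\<lambda>f g. \<forall>n. \<bar>f n\<bar> \<le> g n) fs gs"
  shows "\<bar>nested_sum i N fs\<bar> \<le> nested_sum i N gs"
  using assms
proof (induction fs gs arbitrary: N rule: list_all2_induct)
  case (Cons f fs g gs)
  show ?case
    unfolding nested_sum.simps
    by (rule order.trans[OF sum_abs], rule sum_mono)
       (use Cons in \<open>auto simp: abs_mult intro!: mult_mono intro: order.trans[OF abs_ge_zero]\<close>)
qed simp

text \<open>The truncation bounds only the largest variable directly, so the values for varying
  \<open>N\<close> are the partial sums of one series, to which ordinary comparison applies.\<close>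

lemma nested_sum_convergent:
  fixes fs gs :: "(nat \<Rightarrow> real) list"
  assumes "list_all2 (\<lambda>f g. \<forall>n. \<bar>f n\<bar> \<le> g n) fs gs" "convergent (\<lambda>N. nested_sum 0 N gs)"
  shows "convergent (\<lambda>N. nested_sum 0 N fs)"
proof (cases fs)
  case Nil
  then show ?thesis by (simp add: convergent_const)
next
  case (Cons f fs')
  then obtain g gs' where gs: "gs = g # gs'" and fg: "\<And>n. \<bar>f n\<bar> \<le> g n"
    and all: "list_all2 (\<lambda>f g. \<forall>n. \<bar>f n\<bar> \<le> g n) fs' gs'"
    using assms(1) by (auto simp: list_all2_Cons1)
  have eq: "nested_sum 0 N (h # hs) = (\<Sum>n<N. h (Suc n) * nested_sum 0 n hs)" for N h and hs :: "(nat \<Rightarrow> real) list"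
    unfolding nested_sum.simps
    by (rule sum.reindex_bij_witness[of _ Suc "\<lambda>n. n - 1"]) auto
  have "summable (\<lambda>n. g (Suc n) * nested_sum 0 n gs')"
    using assms(2) unfolding gs eq by (simp add: summable_iff_convergent)
  then have "summable (\<lambda>n. f (Suc n) * nested_sum 0 n fs')"
    by (rule summable_comparison_test'[of _ 0])
       (auto simp: abs_mult intro!: mult_mono fg nested_sum_abs_le[OF all] order.trans[OF abs_ge_zero fg])
  then show ?thesis
    unfolding Cons eq by (simp add: summable_iff_convergent)
qed

lemma multi_zeta_eq:
  assumes "admissible bs"
  shows "multi_zeta (rev bs) = tail_zeta bs 0"
proof -
  have "multi_zeta (rev bs) = lim (\<lambda>N. nested_sum 0 N (map (\<lambda>a n. 1 / real n ^ a) (rev bs)))"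
    unfolding multi_zeta_def sum_decreasing_tuples[symmetric] by simp
  with nested_sum_tendsto[OF assms, of 0 0] show ?thesis
    by (simp add: limI)
qed

section \<open>Values at integers\<close>

lemma tail_zeta_Cons_of_nat:
  assumes "admissible (b # bs)"
  shows "tail_zeta (b # bs) (real i) = tail_zeta (b # bs) 0 - (\<Sum>k = 1..i. tail_zeta bs (real k) / real k ^ b)"
proof -
  define f where "f = (\<lambda>k. tail_zeta bs (1 + real k) / (1 + real k) ^ b)"
  have "summable f"
    using tail_zeta_summable[OF assms, of 0] unfolding f_def by simp
  from suminf_split_initial_segment[OF this, of i]
  have "tail_zeta (b # bs) 0 = (\<Sum>k. f (k + i)) + (\<Sum>k<i. f k)"
    by (simp add: f_def)
  moreover have "(\<Sum>k<i. f k) = (\<Sum>k = 1..i. tail_zeta bs (real k) / real k ^ b)"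
    by (rule sum.reindex_bij_witness[of _ "\<lambda>k. k - 1" Suc]) (auto simp: f_def)
  moreover have "(\<Sum>k. f (k + i)) = tail_zeta (b # bs) (real i)"
    by (simp add: f_def add_ac)
  ultimately show ?thesis by simp
qed

text \<open>The range beyond \<open>i\<close> is the full range minus \<open>1..i\<close>. On the
  removed part the induction hypothesis is used at \<open>k\<close> itself, so the next variable of
  the truncated sum may equal \<open>k\<close>; this is why star sums appear, with alternating
  signs.\<close>

lemma tail_zeta_antipode:
  "admissible bs \<Longrightarrow> tail_zeta bs (real i) =
     (\<Sum>j\<le>length bs. (-1) ^ j * tail_zeta (drop j bs) 0 * star_zeta (take j bs) i)"
proof (induction bs arbitrary: i)
  case (Cons b bs i)
  have adm: "admissible bs" using Cons.prems by (auto dest: admissible_Cons)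
  have "tail_zeta (b # bs) (real i) = tail_zeta (b # bs) 0 - (\<Sum>k = 1..i. tail_zeta bs (real k) / real k ^ b)"
    by (rule tail_zeta_Cons_of_nat[OF Cons.prems])
  also have "(\<Sum>k = 1..i. tail_zeta bs (real k) / real k ^ b) =
      (\<Sum>k = 1..i. \<Sum>j\<le>length bs. (-1) ^ j * tail_zeta (drop j bs) 0 * (star_zeta (take j bs) k / real k ^ b))"
    unfolding Cons.IH[OF adm] sum_divide_distrib by simp
  also have "\<dots> = (\<Sum>j\<le>length bs. (-1) ^ j * tail_zeta (drop j bs) 0 * star_zeta (b # take j bs) i)"
    by (subst sum.swap) (simp add: sum_distrib_left)
  finally show ?case
    by (simp only: length_Cons sum.atMost_Suc_shift) (simp add: sum_negf del: tail_zeta.simps star_zeta.simps(2))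
qed simp

section \<open>Binomial duality\<close>

text \<open>\<open>binomial_dual x n\<close> is \<open>\<Sum>(-1)\<^bsup>i-1\<^esup> binom(n, i) x\<^sub>i\<close> over \<open>1 \<le> i \<le> n\<close>.\<close>

definition binomial_dual :: "(nat \<Rightarrow> real) \<Rightarrow> nat \<Rightarrow> real" where
  "binomial_dual x n = x 0 - alt_diff x n 0"

definition harmonic_sum :: "(nat \<Rightarrow> real) \<Rightarrow> nat \<Rightarrow> real" where
  "harmonic_sum x n = (\<Sum>k = 1..n. x k / real k)"

lemma alt_diff_harmonic_sum:
  "alt_diff (harmonic_sum x) (Suc n) k = - alt_diff (\<lambda>i. x i / real i) n (Suc k)"
proof (induction n arbitrary: k)
  case 0
  then show ?case by (simp add: harmonic_sum_def)
next
  case (Suc n)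
  have "alt_diff (harmonic_sum x) (Suc (Suc n)) k =
      alt_diff (harmonic_sum x) (Suc n) k - alt_diff (harmonic_sum x) (Suc n) (Suc k)"
    by simp
  then show ?case unfolding Suc by simp
qed

text \<open>Together with \<open>binomial_dual_divide\<close>: binomial duality exchanges the
  operators \<open>harmonic_sum\<close> and division by \<open>n\<close>. Star sums are words in
  these two operators, and Hoffman duality arises from this exchange.\<close>

lemma binomial_dual_harmonic_sum:
  assumes "n \<ge> 1"
  shows "binomial_dual (harmonic_sum x) n = binomial_dual x n / real n"
proof -
  obtain m where m: "n = Suc m" using assms by (cases n) auto
  show ?thesis
    using alt_diff_divide_1[of m x] unfolding binomial_dual_def m alt_diff_harmonic_sum
    by (simp add: harmonic_sum_def field_simps)
qed

lemma binomial_dual_divide: "binomial_dual (\<lambda>i. x i / real i) = harmonic_sum (binomial_dual x)"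
proof
  show "binomial_dual (\<lambda>i. x i / real i) n = harmonic_sum (binomial_dual x) n" for n
  proof (induction n)
    case (Suc n)
    have "alt_diff (\<lambda>i. x i / real i) n 1 = binomial_dual x (Suc n) / real (Suc n)"
      using alt_diff_divide_1[of n x] by (simp add: binomial_dual_def field_simps)
    with Suc show ?case
      by (simp add: binomial_dual_def harmonic_sum_def)
  qed (simp add: binomial_dual_def harmonic_sum_def)
qed

lemma binomial_dual_divide_power:
  "binomial_dual (\<lambda>i. x i / real i ^ b) = (harmonic_sum ^^ b) (binomial_dual x)"
proof (induction b)
  case (Suc b)
  then show ?case
    using binomial_dual_divide[of "\<lambda>i. x i / real i ^ b"] by (simp add: mult.commute)
qed simp

lemma harmonic_sum_cong:
  "(\<And>n. n \<ge> 1 \<Longrightarrow> x n = y n) \<Longrightarrow> n \<ge> 1 \<Longrightarrow> (harmonic_sum ^^ b) x n = (harmonic_sum ^^ b) y n"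
proof (induction b arbitrary: n)
  case (Suc b)
  then show ?case by (auto simp: harmonic_sum_def intro!: sum.cong)
qed simp

fun dual_star :: "nat list \<Rightarrow> nat \<Rightarrow> real" where
  "dual_star [] = (\<lambda>n. 1)"
| "dual_star (b # bs) = (\<lambda>n. (harmonic_sum ^^ (b - 1)) (dual_star bs) n / real n)"

lemma star_zeta_Cons_harmonic_sum:
  assumes "b \<ge> 1"
  shows "star_zeta (b # bs) = harmonic_sum (\<lambda>i. star_zeta bs i / real i ^ (b - 1))"
proof -
  obtain c where "b = Suc c" using assms by (cases b) auto
  then show ?thesis by (auto simp: harmonic_sum_def mult.commute)
qed

text \<open>The case \<open>n = 0\<close> fails for the empty index, where the dual is 0 but
  \<open>dual_star\<close> is 1. Since \<open>harmonic_sum\<close> reads its argument only from 1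
  on, the restriction survives the induction.\<close>

lemma binomial_dual_star_zeta:
  assumes "\<forall>b\<in>set bs. b \<ge> 1" "n \<ge> 1"
  shows "binomial_dual (star_zeta bs) n = dual_star bs n"
  using assms
proof (induction bs arbitrary: n)
  case Nil
  have "star_zeta [] = (\<lambda>n. 1)" by auto
  with Nil show ?case by (simp add: binomial_dual_def alt_diff_const)
next
  case (Cons b bs n)
  have "binomial_dual (star_zeta (b # bs)) n =
      (harmonic_sum ^^ (b - 1)) (binomial_dual (star_zeta bs)) n / real n"
    using Cons.prems
    by (simp only: star_zeta_Cons_harmonic_sum binomial_dual_harmonic_sum binomial_dual_divide_power list.set ball_simps)
  also have "(harmonic_sum ^^ (b - 1)) (binomial_dual (star_zeta bs)) n = (harmonic_sum ^^ (b - 1)) (dual_star bs) n"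
    using Cons by (intro harmonic_sum_cong) auto
  finally show ?case by simp
qed

text \<open>The exponent 1/4 is a convenient substitute for powers of logarithms: being positive it
  is preserved by \<open>harmonic_sum\<close>, and being below 1/2 it leaves the series with weights
  of order \<open>n powr (- 1 / 2)\<close> and a factor \<open>1 / n\<close> summable.\<close>

definition root_growth :: "(nat \<Rightarrow> real) \<Rightarrow> bool" where
  "root_growth x \<longleftrightarrow> (\<exists>C. \<forall>n\<ge>1. 0 \<le> x n \<and> x n \<le> C * real n powr (1 / 4))"

lemma root_growth_const: "root_growth (\<lambda>n. 1)"
  unfolding root_growth_def by (intro exI[of _ 1]) (auto simp: ge_one_powr_ge_zero)

text \<open>A discrete version of the derivative of \<open>4 * t powr (1 / 4)\<close>, obtained by
  factoring \<open>y ^ 4 - x ^ 4 = 1\<close>.\<close>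

lemma powr_quarter_step: "real (Suc n) powr (- 3 / 4) \<le> 4 * (real (Suc n) powr (1 / 4) - real n powr (1 / 4))"
proof -
  define x y where "x = real n powr (1 / 4)" and "y = real (Suc n) powr (1 / 4)"
  have xy: "0 \<le> x" "x \<le> y" "y > 0"
    by (auto simp: x_def y_def intro!: powr_mono2)
  have x4: "x ^ 4 = real n" and y4: "y ^ 4 = real (Suc n)"
    by (auto simp: x_def y_def powr_powr simp flip: powr_realpow' powr_numeral)
  have "real (Suc n) powr (- 3 / 4) = 1 / y ^ 3"
    by (simp add: y_def powr_powr powr_minus_divide flip: powr_numeral)
  moreover have "1 \<le> (y - x) * (4 * y ^ 3)"
  proof -
    have "1 = (y - x) * (y ^ 3 + y ^ 2 * x + y * x ^ 2 + x ^ 3)"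
      using x4 y4 by (simp add: algebra_simps power_numeral_reduce power2_eq_square)
    also have "y ^ 3 + y ^ 2 * x + y * x ^ 2 + x ^ 3 \<le> y ^ 3 + y ^ 2 * y + y * y ^ 2 + y ^ 3"
      using xy by (intro add_mono mult_left_mono mult_right_mono power_mono) auto
    then have "(y - x) * (y ^ 3 + y ^ 2 * x + y * x ^ 2 + x ^ 3) \<le> (y - x) * (4 * y ^ 3)"
      using xy by (intro mult_left_mono) (auto simp: power3_eq_cube power2_eq_square)
    finally show ?thesis .
  qed
  then have "1 / y ^ 3 \<le> 4 * (y - x)"
    using xy by (simp add: field_simps)
  ultimately show ?thesis
    by (simp only: x_def y_def)
qed

lemma root_growth_harmonic_sum:
  assumes "root_growth x"
  shows "root_growth (harmonic_sum x)"
proof -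
  from assms obtain C where C: "\<And>n. n \<ge> 1 \<Longrightarrow> 0 \<le> x n" "\<And>n. n \<ge> 1 \<Longrightarrow> x n \<le> C * real n powr (1 / 4)"
    by (auto simp: root_growth_def)
  have "C \<ge> 0" using C[of 1] by simp
  have "0 \<le> harmonic_sum x n \<and> harmonic_sum x n \<le> 4 * C * real n powr (1 / 4)" for n
  proof (induction n)
    case 0
    then show ?case by (simp add: harmonic_sum_def)
  next
    case (Suc n)
    have "x (Suc n) / real (Suc n) \<le> C * real (Suc n) powr (1 / 4) / real (Suc n)"
      using C(2)[of "Suc n"] by (intro divide_right_mono) auto
    also have "\<dots> = C * real (Suc n) powr (- 3 / 4)"
      using powr_diff[of "real (Suc n)" "1 / 4" 1] by simp
    also have "\<dots> \<le> C * (4 * (real (Suc n) powr (1 / 4) - real n powr (1 / 4)))"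
      using \<open>C \<ge> 0\<close> by (intro mult_left_mono powr_quarter_step)
    finally have "x (Suc n) / real (Suc n) \<le> 4 * C * real (Suc n) powr (1 / 4) - 4 * C * real n powr (1 / 4)"
      by (simp add: algebra_simps)
    moreover have "harmonic_sum x (Suc n) = harmonic_sum x n + x (Suc n) / real (Suc n)"
      by (simp add: harmonic_sum_def)
    moreover have "x (Suc n) / real (Suc n) \<ge> 0" using C(1)[of "Suc n"] by simp
    ultimately show ?case using Suc by linarith
  qed
  then show ?thesis unfolding root_growth_def by blast
qed

lemma root_growth_divide:
  assumes "root_growth x"
  shows "root_growth (\<lambda>n. x n / real n)"
proof -
  from assms obtain C where C: "\<And>n. n \<ge> 1 \<Longrightarrow> 0 \<le> x n" "\<And>n. n \<ge> 1 \<Longrightarrow> x n \<le> C * real n powr (1 / 4)"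
    by (auto simp: root_growth_def)
  have "x n / real n \<le> C * real n powr (1 / 4)" if "n \<ge> 1" for n
  proof -
    have "x n / real n \<le> x n / 1" using C(1)[OF that] that by (intro divide_left_mono) auto
    then show ?thesis using C(2)[OF that] by simp
  qed
  then show ?thesis using C(1) unfolding root_growth_def by (intro exI[of _ C]) auto
qed

lemma root_growth_harmonic_sum_power: "root_growth x \<Longrightarrow> root_growth ((harmonic_sum ^^ b) x)"
  by (induction b) (auto intro: root_growth_harmonic_sum)

lemma root_growth_dual_star: "root_growth (dual_star bs)"
  by (induction bs) (auto intro: root_growth_const root_growth_divide root_growth_harmonic_sum_power)

lemma summable_central_weight_divide:
  assumes "root_growth x"
  shows "summable (\<lambda>n. central_weight n * (x n / real n))"
proof -
  from assms obtain C where C: "\<And>n. n \<ge> 1 \<Longrightarrow> 0 \<le> x n" "\<And>n. n \<ge> 1 \<Longrightarrow> x n \<le> C * real n powr (1 / 4)"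
    by (auto simp: root_growth_def)
  have "summable (\<lambda>n. C * real n powr (- 5 / 4))"
    by (intro summable_mult) (simp add: summable_real_powr_iff)
  then show ?thesis
  proof (rule summable_comparison_test'[of _ 1])
    fix n :: nat assume n: "n \<ge> 1"
    have "central_weight n \<le> 1 / sqrt (2 * real n + 1)" by (rule central_weight_le)
    also have "\<dots> \<le> 1 / sqrt (real n)"
      using n by (intro divide_left_mono) auto
    also have "\<dots> = real n powr (- 1 / 2)"
      using n by (simp add: powr_minus_divide powr_half_sqrt)
    finally have w: "central_weight n \<le> real n powr (- 1 / 2)" .
    have "x n / real n \<le> C * real n powr (1 / 4) / real n"
      using C(2)[OF n] by (intro divide_right_mono) auto
    also have "\<dots> = C * real n powr (- 3 / 4)"
      using n powr_diff[of "real n" "1 / 4" 1] by simp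
    finally have "central_weight n * (x n / real n) \<le> real n powr (- 1 / 2) * (C * real n powr (- 3 / 4))"
      using w C(1)[OF n] by (intro mult_mono) auto
    also have "\<dots> = C * real n powr (- 5 / 4)"
      by (simp flip: powr_add)
    finally show "norm (central_weight n * (x n / real n)) \<le> C * real n powr (- 5 / 4)"
      using C(1)[OF n] central_weight_pos[of n] by simp
  qed
qed

text \<open>The term \<open>n = 0\<close> of the Newton series at 0 is the value at 0; in the later
  terms the antipode relation is differenced piece by piece. The growth bound makes each of the
  finitely many pieces summable, which is needed to split the series.\<close>

lemma tail_zeta_minus_half:
  assumes "admissible bs"
  shows "tail_zeta bs (- 1 / 2) = tail_zeta bs 0 + (\<Sum>j = 1..length bs.
    (-1) ^ (j - 1) * tail_zeta (drop j bs) 0 * (\<Sum>n. central_weight (Suc n) * dual_star (take j bs) (Suc n)))"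
proof -
  define c where "c j = (-1) ^ (j - 1) * tail_zeta (drop j bs) 0" for j
  have alt: "alt_diff (\<lambda>i. tail_zeta bs (real i)) (Suc n) 0 = (\<Sum>j = 1..length bs. c j * dual_star (take j bs) (Suc n))" for n
  proof -
    have "alt_diff (\<lambda>i. tail_zeta bs (real i)) (Suc n) 0 =
        (\<Sum>j\<le>length bs. (-1) ^ j * tail_zeta (drop j bs) 0 * alt_diff (star_zeta (take j bs)) (Suc n) 0)"
      unfolding tail_zeta_antipode[OF assms] alt_diff_sum alt_diff_cmult ..
    also have "\<dots> = (\<Sum>j\<in>{1..length bs}. (-1) ^ j * tail_zeta (drop j bs) 0 * alt_diff (star_zeta (take j bs)) (Suc n) 0)"
    proof (rule sum.mono_neutral_right)
      \<comment> \<open>The piece \<open>j = 0\<close> is constant, so its differences of positive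
        order vanish.\<close>
      have "star_zeta [] = (\<lambda>i. 1)" by auto
      then have "alt_diff (star_zeta []) (Suc n) 0 = 0" by (simp only: alt_diff_const) simp
      then show "\<forall>j\<in>{..length bs} - {1..length bs}.
          (-1) ^ j * tail_zeta (drop j bs) 0 * alt_diff (star_zeta (take j bs)) (Suc n) 0 = 0"
        by (auto simp del: alt_diff.simps simp: not_less_eq_eq)
    qed auto
    also have "\<dots> = (\<Sum>j = 1..length bs. c j * dual_star (take j bs) (Suc n))"
    proof (rule sum.cong[OF refl])
      fix j assume j: "j \<in> {1..length bs}"
      have "\<forall>b\<in>set (take j bs). b \<ge> 1"
        using assms by (auto simp: admissible_def dest: in_set_takeD)
      from binomial_dual_star_zeta[OF this, of "Suc n"]
      have "star_zeta (take j bs) 0 - alt_diff (star_zeta (take j bs)) (Suc n) 0 = dual_star (take j bs) (Suc n)"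
        by (simp add: binomial_dual_def del: alt_diff.simps)
      \<comment> \<open>An empty sum, since \<open>j >= 1\<close>; hence the difference is exactly
        minus the binomial dual, which turns \<open>(-1) ^ j\<close> into
        \<open>(-1) ^ (j - 1)\<close>.\<close>
      moreover have "star_zeta (take j bs) 0 = 0"
        using j by (cases bs; cases j) auto
      ultimately have "alt_diff (star_zeta (take j bs)) (Suc n) 0 = - dual_star (take j bs) (Suc n)" by linarith
      moreover have "(-1 :: real) ^ j = - ((-1) ^ (j - 1))"
        using j by (cases j) auto
      ultimately show "(-1) ^ j * tail_zeta (drop j bs) 0 * alt_diff (star_zeta (take j bs)) (Suc n) 0 =
          c j * dual_star (take j bs) (Suc n)"
        by (simp add: c_def del: alt_diff.simps)
    qed
    finally show ?thesis .
  qed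
  have summ: "summable (\<lambda>n. central_weight (Suc n) * dual_star (take j bs) (Suc n))" if "j \<in> {1..length bs}" for j
  proof -
    from that obtain b cs where "take j bs = b # cs" by (cases bs; cases j) auto
    then have "summable (\<lambda>n. central_weight n * dual_star (take j bs) n)"
      using summable_central_weight_divide[OF root_growth_harmonic_sum_power[OF root_growth_dual_star]]
      by simp
    then show ?thesis by (subst summable_Suc_iff)
  qed
  have "(\<lambda>n. central_weight n * alt_diff (\<lambda>i. tail_zeta bs (real i)) n 0) sums tail_zeta bs (- 1 / 2)"
    using newton_rep_tail_zeta[OF assms, of 0] by (simp add: newton_rep_def)
  then have "(\<lambda>n. central_weight (Suc n) * alt_diff (\<lambda>i. tail_zeta bs (real i)) (Suc n) 0) sums
      (tail_zeta bs (- 1 / 2) - tail_zeta bs 0)"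
    by (subst sums_Suc_iff) simp
  then have "tail_zeta bs (- 1 / 2) - tail_zeta bs 0 =
      (\<Sum>n. \<Sum>j = 1..length bs. c j * (central_weight (Suc n) * dual_star (take j bs) (Suc n)))"
    unfolding alt by (simp add: sums_iff sum_distrib_left mult_ac)
  also have "\<dots> = (\<Sum>j = 1..length bs. \<Sum>n. c j * (central_weight (Suc n) * dual_star (take j bs) (Suc n)))"
    using summ by (intro suminf_sum summable_mult) auto
  also have "\<dots> = (\<Sum>j = 1..length bs. c j * (\<Sum>n. central_weight (Suc n) * dual_star (take j bs) (Suc n)))"
    using summ by (intro sum.cong refl suminf_mult) auto
  finally show ?thesis by (simp add: c_def)
qed

text \<open>The sum of \<open>1 / (x + 1 + j)\<close> over \<open>j\<close> diverges, so
  \<open>newton_rep_suminf\<close> cannot be applied to it. Dropping the term \<open>n = 0\<close>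
  from the expansion of each \<open>1 / x\<close> leaves a nonnegative double series: summed over
  \<open>n\<close> first it becomes twice the alternating harmonic series, summed over
  \<open>j\<close> first it telescopes to the series in question.\<close>

lemma suminf_central_weight_divide: "(\<Sum>n. central_weight (Suc n) / real (Suc n)) = 2 * ln 2"
proof -
  define u where "u = (\<lambda>i. 1 / real i)"
  have rep: "newton_rep (\<lambda>x. 1 / x) (Suc k)" for k
    using newton_rep_divide[OF newton_rep_1] by simp
  define f where "f j n = central_weight (Suc n) * alt_diff u (Suc n) (Suc j)" for j n
  define g where "g j = 1 / (real (Suc j) - 1 / 2) - 1 / real (Suc j)" for j
  have g: "g sums (2 * ln 2)"
  proof -
    have "(\<lambda>j. 2 * (inverse (real (2 * j + 1)) - inverse (real (2 * j + 2)))) sums (2 * ln 2)"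
      by (intro sums_mult alternating_harmonic_series_sums')
    moreover have "2 * (inverse (real (2 * j + 1)) - inverse (real (2 * j + 2))) = g j" for j
    proof -
      have eqs: "real (Suc j) - 1 / 2 = real (2 * j + 1) / 2" "real (Suc j) = real (2 * j + 2) / 2"
        by (simp_all add: field_simps)
      have "g j = 1 / (real (2 * j + 1) / 2) - 1 / (real (2 * j + 2) / 2)"
        unfolding g_def eqs(1) unfolding eqs(2) ..
      then show ?thesis by (simp add: inverse_eq_divide)
    qed
    ultimately show ?thesis by simp
  qed
  have "(\<lambda>n. \<Sum>j. f j n) sums (\<Sum>j. g j)"
  proof (rule sums_suminf_swap)
    show "0 \<le> f j n" for j n
      using rep[of j] central_weight_pos[of "Suc n"] by (simp add: newton_rep_def f_def u_def del: alt_diff.simps)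
    have "(\<lambda>n. central_weight n * alt_diff u n (Suc j)) sums (1 / (real (Suc j) - 1 / 2))" for j
      using rep[of j] by (simp add: newton_rep_def u_def del: of_nat_Suc)
    then show "f j sums g j" for j
      unfolding f_def by (subst sums_Suc_iff) (simp add: g_def u_def)
    show "summable g" using g by (simp add: sums_iff)
  qed
  moreover have "(\<Sum>j. f j n) = central_weight (Suc n) / real (Suc n)" for n
  proof -
    have "(\<lambda>k. alt_diff u n k) \<longlonglongrightarrow> 0" for n
    proof (induction n)
      case 0
      show ?case unfolding u_def by (simp add: lim_1_over_n)
    next
      case (Suc n)
      from tendsto_diff[OF Suc LIMSEQ_Suc[OF Suc]] show ?case by simp
    qed
    from telescope_sums'[OF LIMSEQ_Suc[OF this[of n]]]
    have "(\<lambda>j. alt_diff u (Suc n) (Suc j)) sums alt_diff u n 1" by simp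
    moreover have "alt_diff u n 1 = 1 / real (Suc n)"
      using alt_diff_divide_1[of n "\<lambda>i. 1"] alt_diff_const[of 1 "Suc n" 0]
      by (simp add: u_def field_simps del: alt_diff.simps)
    ultimately have "(\<lambda>j. f j n) sums (central_weight (Suc n) * (1 / real (Suc n)))"
      unfolding f_def by (intro sums_mult) simp
    then show ?thesis by (simp add: sums_iff)
  qed
  ultimately show ?thesis using g by (simp add: sums_iff)
qed

section \<open>Hoffman duality\<close>

text \<open>
  An index is encoded by the word of length \<open>|a|\<close> whose letter at position \<open>i\<close> tells whether \<open>i\<close> is
  \<open>0\<close> or a partial sum; Hoffman duality flips all letters but the first.
\<close>

definition index_word :: "nat list \<Rightarrow> bool list" where
  "index_word ks = concat (map (\<lambda>k. True # replicate (k - 1) False) ks)"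

lemma index_word_Nil [simp]: "index_word [] = []"
  by (simp add: index_word_def)

lemma index_word_Cons: "index_word (k # ks) = True # replicate (k - 1) False @ index_word ks"
  by (simp add: index_word_def)

lemma length_index_word: "\<forall>k\<in>set ks. k \<ge> 1 \<Longrightarrow> length (index_word ks) = sum_list ks"
  by (induction ks) (auto simp: index_word_Cons)

lemma index_word_nth:
  assumes "\<forall>k\<in>set ks. k \<ge> 1" "i < sum_list ks"
  shows "index_word ks ! i \<longleftrightarrow> (\<exists>j<length ks. i = sum_list (take j ks))"
  using assms
proof (induction ks arbitrary: i)
  case (Cons k ks)
  have split: "(\<exists>j<length (k # ks). i = sum_list (take j (k # ks))) \<longleftrightarrow>
      i = 0 \<or> (\<exists>j<length ks. i = k + sum_list (take j ks))"
    by (simp add: Ex_less_Suc2)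
  have word: "index_word (k # ks) = (True # replicate (k - 1) False) @ index_word ks"
    by (simp add: index_word_Cons)
  show ?case
  proof (cases "i < k")
    case True
    then have "index_word (k # ks) ! i \<longleftrightarrow> i = 0"
      unfolding word by (cases i) (auto simp: nth_append)
    then show ?thesis unfolding split using True by auto
  next
    case False
    have "length (True # replicate (k - 1) False) = k" using Cons.prems by auto
    then have "index_word (k # ks) ! i = index_word ks ! (i - k)"
      unfolding word using False by (simp only: nth_append if_False)
    also have "\<dots> \<longleftrightarrow> (\<exists>j<length ks. i - k = sum_list (take j ks))"
      using Cons.prems False by (intro Cons.IH) auto
    also have "\<dots> \<longleftrightarrow> i = 0 \<or> (\<exists>j<length ks. i = k + sum_list (take j ks))"
      using False Cons.prems by auto
    finally show ?thesis unfolding split .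
  qed
qed simp

lemma proper_partial_sums_eq:
  assumes "\<forall>k\<in>set ks. k \<ge> 1"
  shows "proper_partial_sums ks = {i \<in> {1..<sum_list ks}. index_word ks ! i}"
proof -
  have bounds: "0 < sum_list (take j ks) \<and> sum_list (take j ks) < sum_list ks" if "1 \<le> j" "j < length ks" for j
  proof -
    have pos: "0 < sum_list xs" if "xs \<noteq> []" "set xs \<subseteq> set ks" for xs
      using that assms by (cases xs) auto
    have "sum_list ks = sum_list (take j ks) + sum_list (drop j ks)"
      by (metis append_take_drop_id sum_list_append)
    moreover have "0 < sum_list (take j ks)"
      using that set_take_subset[of j ks] by (intro pos) auto
    moreover have "0 < sum_list (drop j ks)"
      using that set_drop_subset[of j ks] by (intro pos) auto
    ultimately show ?thesis by simp
  qed
  show ?thesis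
  proof (intro set_eqI iffI)
    fix i assume "i \<in> proper_partial_sums ks"
    then obtain j where "i = sum_list (take j ks)" "1 \<le> j" "j < length ks"
      by (auto simp: proper_partial_sums_def)
    then show "i \<in> {i \<in> {1..<sum_list ks}. index_word ks ! i}"
      using bounds[of j] index_word_nth[OF assms, of i] by auto
  next
    fix i assume i: "i \<in> {i \<in> {1..<sum_list ks}. index_word ks ! i}"
    then obtain j where j: "j < length ks" "i = sum_list (take j ks)"
      using index_word_nth[OF assms, of i] by auto
    moreover have "j \<noteq> 0" using i j by (intro notI) simp
    ultimately show "i \<in> proper_partial_sums ks"
      unfolding proper_partial_sums_def by (auto intro!: exI[of _ j])
  qed
qed

lemma index_word_hd: "index_word ks = [] \<or> hd (index_word ks)"
  by (cases ks) (auto simp: index_word_Cons)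

lemma index_word_inject:
  assumes "index_word ks = index_word ls" "\<forall>k\<in>set ks. k \<ge> 1" "\<forall>k\<in>set ls. k \<ge> 1"
  shows "ks = ls"
  using assms
proof (induction ks arbitrary: ls)
  case Nil
  then show ?case by (cases ls) (auto simp: index_word_Cons)
next
  case (Cons k ks)
  then obtain l ls' where ls: "ls = l # ls'" by (cases ls) (auto simp: index_word_Cons)
  \<comment> \<open>The run of \<open>False\<close> after the first letter recovers the first entry,
    because the next entry opens with \<open>True\<close>.\<close>
  have tw: "takeWhile Not (replicate n False @ index_word xs) = replicate n False" for n xs
  proof (induction n)
    case 0
    then show ?case using index_word_hd[of xs] by (cases "index_word xs") auto
  qed simp
  have eq: "replicate (k - 1) False @ index_word ks = replicate (l - 1) False @ index_word ls'"
    using Cons.prems(1) by (simp add: ls index_word_Cons)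
  then have "replicate (k - 1) False = replicate (l - 1) False"
    using tw by metis
  then have kl: "k - 1 = l - 1" using length_replicate by metis
  then have "index_word ks = index_word ls'" using eq by simp
  then show ?case using Cons kl by (auto simp: ls)
qed

lemma index_word_surj:
  "w = [] \<or> hd w \<Longrightarrow> \<exists>ks. (\<forall>k\<in>set ks. k \<ge> 1) \<and> index_word ks = w"
proof (induction w rule: length_induct)
  case (1 w)
  show ?case
  proof (cases w)
    case Nil
    then show ?thesis by (intro exI[of _ "[]"]) simp
  next
    case (Cons b v)
    define n where "n = length (takeWhile Not v)"
    have "takeWhile Not v = replicate n False"
      unfolding n_def by (rule replicate_eqI) (auto dest: set_takeWhileD)
    then have v: "v = replicate n False @ dropWhile Not v"
      by (metis takeWhile_dropWhile_id)
    have "dropWhile Not v = [] \<or> hd (dropWhile Not v)"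
      using hd_dropWhile[of Not v] by auto
    moreover have "length (dropWhile Not v) < length w"
      using length_dropWhile_le[of Not v] by (simp add: Cons)
    ultimately obtain ks where ks: "\<forall>k\<in>set ks. k \<ge> 1" "index_word ks = dropWhile Not v"
      using "1.IH" by blast
    have "index_word (Suc n # ks) = w"
      using 1 v ks by (simp add: index_word_Cons Cons)
    then show ?thesis using ks by (intro exI[of _ "Suc n # ks"]) auto
  qed
qed

text \<open>A disjoint union equal to all of \<open>{1..<sum_list a}\<close> means complementary
  letters at every position but 0. Words and indices correspond bijectively, so the flipped word
  also provides the existence and uniqueness behind \<open>THE\<close>.\<close>

lemma hoffman_dual_word:
  assumes "a \<noteq> []" "\<forall>k\<in>set a. k \<ge> 1"
  shows "(\<forall>k\<in>set (hoffman_dual a). k \<ge> 1) \<and> index_word (hoffman_dual a) = True # map Not (tl (index_word a))"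
proof -
  define w where "w = True # map Not (tl (index_word a))"
  define P where "P b \<longleftrightarrow> (\<forall>k\<in>set b. 1 \<le> k) \<and> sum_list b = sum_list a \<and>
      proper_partial_sums a \<union> proper_partial_sums b = {1..<sum_list a} \<and>
      proper_partial_sums a \<inter> proper_partial_sums b = {}" for b
  have pos: "sum_list a > 0" using assms by (cases a) auto
  have len: "length w = sum_list a"
    using pos by (simp add: w_def length_index_word[OF assms(2)])
  have w_nth: "w ! i = (\<not> index_word a ! i)" if "i \<in> {1..<sum_list a}" for i
    using that length_index_word[OF assms(2)] by (cases i) (auto simp: w_def nth_tl)
  have iff: "P b \<longleftrightarrow> (\<forall>k\<in>set b. 1 \<le> k) \<and> index_word b = w" for b
  proof
    assume "P b"
    then have b: "\<forall>k\<in>set b. 1 \<le> k" "sum_list b = sum_list a"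
      and un: "proper_partial_sums a \<union> proper_partial_sums b = {1..<sum_list a}"
      and int: "proper_partial_sums a \<inter> proper_partial_sums b = {}"
      by (auto simp: P_def)
    have "b \<noteq> []" using b(2) pos by (metis less_irrefl sum_list.Nil)
    have "index_word b = w"
    proof (rule nth_equalityI)
      show "length (index_word b) = length w" using b len by (simp add: length_index_word)
      fix i assume "i < length (index_word b)"
      then have i: "i < sum_list a" using b by (simp add: length_index_word)
      show "index_word b ! i = w ! i"
      proof (cases "i = 0")
        case True
        then show ?thesis using \<open>b \<noteq> []\<close> by (cases b) (auto simp: index_word_Cons w_def)
      next
        case False
        then have i': "i \<in> {1..<sum_list a}" using i by auto
        then have "index_word b ! i \<longleftrightarrow> i \<in> proper_partial_sums b"
          using b by (auto simp: proper_partial_sums_eq)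
        also have "\<dots> \<longleftrightarrow> i \<notin> proper_partial_sums a" using un int i' by blast
        also have "\<dots> \<longleftrightarrow> \<not> index_word a ! i"
          using i' assms(2) by (auto simp: proper_partial_sums_eq)
        finally show ?thesis using w_nth[OF i'] by simp
      qed
    qed
    with b show "(\<forall>k\<in>set b. 1 \<le> k) \<and> index_word b = w" by simp
  next
    assume b: "(\<forall>k\<in>set b. 1 \<le> k) \<and> index_word b = w"
    then have s: "sum_list b = sum_list a" using len length_index_word[of b] by simp
    have "proper_partial_sums b = {i \<in> {1..<sum_list a}. w ! i}"
      using b s by (simp add: proper_partial_sums_eq)
    also have "\<dots> = {i \<in> {1..<sum_list a}. \<not> index_word a ! i}"
      using w_nth by blast
    finally have eq_b: "proper_partial_sums b = {i \<in> {1..<sum_list a}. \<not> index_word a ! i}" .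
    have eq_a: "proper_partial_sums a = {i \<in> {1..<sum_list a}. index_word a ! i}"
      using assms(2) by (rule proper_partial_sums_eq)
    show "P b" unfolding P_def eq_a eq_b using b s by blast
  qed
  obtain b where "(\<forall>k\<in>set b. 1 \<le> k) \<and> index_word b = w"
    using index_word_surj[of w] by (auto simp: w_def)
  then have "\<exists>!b. P b"
    unfolding iff by (intro ex1I[of _ b]) (auto intro: index_word_inject)
  then have "P (hoffman_dual a)"
    unfolding hoffman_dual_def P_def by (rule theI')
  then show ?thesis unfolding iff w_def by simp
qed

text \<open>With this reading of letters as operators a star sum is the function of its own index
  word, and binomial duality becomes the flip of all letters.\<close>

definition word_fun :: "bool list \<Rightarrow> nat \<Rightarrow> real" where
  "word_fun w = foldr (\<lambda>b x. if b then harmonic_sum x else (\<lambda>n. x n / real n)) w (\<lambda>n. 1)"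

lemma word_fun_simps [simp]:
  "word_fun [] = (\<lambda>n. 1)"
  "word_fun (True # w) = harmonic_sum (word_fun w)"
  "word_fun (False # w) = (\<lambda>n. word_fun w n / real n)"
  by (simp_all add: word_fun_def)

lemma word_fun_replicate:
  "word_fun (replicate c True @ w) = (harmonic_sum ^^ c) (word_fun w)"
  "word_fun (replicate c False @ w) = (\<lambda>n. word_fun w n / real n ^ c)"
  by (induction c) (auto simp: mult.commute)

lemma star_zeta_word_fun: "\<forall>k\<in>set ks. k \<ge> 1 \<Longrightarrow> star_zeta ks = word_fun (index_word ks)"
proof (induction ks)
  case Nil
  show ?case by auto
next
  case (Cons k ks)
  then show ?case
    by (simp add: star_zeta_Cons_harmonic_sum index_word_Cons word_fun_replicate del: star_zeta.simps(2))
qed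

lemma dual_star_word_fun: "dual_star bs = word_fun (map Not (index_word bs))"
  by (induction bs) (auto simp: index_word_Cons word_fun_replicate)

text \<open>The index with first entry \<open>m 1 + 1\<close> has one more \<open>False\<close>
  after its initial letter than \<open>index_m m j\<close>. Flipping all its letters therefore gives
  \<open>False\<close>, the factor \<open>1 / n\<close>, followed by the word of the Hoffman dual.
  This explains why the first entry of \<open>index_m\<close> lacks the \<open>+ 1\<close>.\<close>

lemma dual_star_hoffman_dual:
  assumes "m 1 \<ge> 1" "j \<ge> 1"
  shows "dual_star (map (\<lambda>i. m i + 1) [1..<j + 1]) n = star_zeta (hoffman_dual (index_m m j)) n / real n"
proof -
  obtain c where c: "m (Suc 0) = Suc c" using assms(1) by (cases "m 1") auto
  have "[1..<j + 1] = 1 # [2..<j + 1]"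
    using assms(2) by (simp add: upt_conv_Cons numeral_2_eq_2 del: upt_Suc)
  then have word: "map Not (index_word (map (\<lambda>i. m i + 1) [1..<j + 1])) =
      False # True # map Not (tl (index_word (index_m m j)))"
    by (simp add: index_m_def index_word_Cons c)
  have "index_m m j \<noteq> []" "\<forall>k\<in>set (index_m m j). k \<ge> 1"
    using assms(1) by (auto simp: index_m_def)
  from hoffman_dual_word[OF this] show ?thesis
    unfolding dual_star_word_fun word by (simp add: star_zeta_word_fun)
qed

text \<open>An entry 1 is the single letter \<open>True\<close>, which flips to a division by
  \<open>n\<close>.\<close>

lemma dual_star_replicate_append: "dual_star (replicate j 1 @ bs) n = dual_star bs n / real n ^ j"
  by (induction j) (auto simp: mult.commute)

lemma zeta_B_star_eq:
  "zeta_B_star k ks = (\<Sum>n. central_weight (Suc n) * (star_zeta ks (Suc n) / real (Suc n) ^ k))"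
  unfolding zeta_B_star_def central_weight_def Let_def multi_zeta_star_trunc_eq by (simp add: mult_ac)

section \<open>Sums over signs\<close>

definition multi_polylog_trunc :: "nat list \<Rightarrow> real list \<Rightarrow> nat \<Rightarrow> real" where
  "multi_polylog_trunc a x N = (\<Sum>ns\<in>decreasing_tuples N (length a).
     \<Prod>i<length a. (x ! i) ^ (ns ! i) / real (ns ! i) ^ (a ! i))"

lemma multi_polylog_tendsto:
  assumes "admissible (rev a)" "length x = length a" "\<forall>y\<in>set x. \<bar>y\<bar> \<le> 1"
  shows "multi_polylog_trunc a x \<longlonglongrightarrow> multi_polylog a x"
proof -
  define fs where "fs = map2 (\<lambda>k y n. y ^ n / real n ^ k) a x"
  have trunc: "multi_polylog_trunc a x = (\<lambda>N. nested_sum 0 N fs)"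
  proof
    fix N
    have "length fs = length a" by (simp add: fs_def assms(2))
    moreover have "(fs ! i) n = (x ! i) ^ n / real n ^ (a ! i)" if "i < length a" for i n
      using that by (simp add: fs_def assms(2))
    ultimately show "multi_polylog_trunc a x N = nested_sum 0 N fs"
      unfolding multi_polylog_trunc_def sum_decreasing_tuples[symmetric] by simp
  qed
  have "convergent (\<lambda>N. nested_sum 0 N (map (\<lambda>k n. 1 / (real n + 0) ^ k) (rev (rev a))))"
    using nested_sum_tendsto[OF assms(1), of 0 0] unfolding convergent_def by auto
  moreover have "list_all2 (\<lambda>f g. \<forall>n. \<bar>f n\<bar> \<le> g n) fs (map (\<lambda>k n. 1 / (real n + 0) ^ k) (rev (rev a)))"
  proof -
    have "\<bar>x ! i ^ n / real n ^ (a ! i)\<bar> \<le> 1 / (real n + 0) ^ (a ! i)" if "i < length a" for i n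
    proof -
      have "\<bar>x ! i\<bar> \<le> 1" using assms(2,3) that by simp
      then have "\<bar>x ! i\<bar> ^ n \<le> 1" by (intro power_le_one) auto
      then show ?thesis by (simp add: power_abs divide_right_mono)
    qed
    then show ?thesis by (simp add: list_all2_conv_all_nth fs_def assms(2))
  qed
  ultimately have "convergent (\<lambda>N. nested_sum 0 N fs)" by (rule nested_sum_convergent[rotated])
  then have "multi_polylog_trunc a x \<longlonglongrightarrow> lim (multi_polylog_trunc a x)"
    unfolding trunc convergent_LIMSEQ_iff .
  moreover have "lim (multi_polylog_trunc a x) = multi_polylog a x"
    unfolding multi_polylog_def multi_polylog_trunc_def by simp
  ultimately show ?thesis by simp
qed

lemma length_sigma_args: "q \<ge> 1 \<Longrightarrow> length (sigma_args \<sigma> q) = q"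
  by (simp add: sigma_args_def)

lemma sigma_args_bound:
  assumes "q \<ge> 1" "\<sigma> \<in> {1..q} \<rightarrow>\<^sub>E {-1, 1 :: real}" "y \<in> set (sigma_args \<sigma> q)"
  shows "\<bar>y\<bar> \<le> 1"
proof -
  have "\<bar>\<sigma> s\<bar> = 1" if "1 \<le> s" "s \<le> q" for s
    using PiE_mem[OF assms(2), of s] that by auto
  then show ?thesis
    using assms(1,3) by (auto simp: sigma_args_def abs_mult)
qed

text \<open>Each sign occurs in two neighbouring arguments, so collecting powers by sign pairs
  consecutive exponents. The factor \<open>\<sigma> 1 ^ g q\<close> completes the pair at
  \<open>s = 1\<close>; leaving \<open>g q\<close> free lets one identity serve both polylogarithm
  sums.\<close>

lemma prod_sigma_args:
  fixes \<sigma> :: "nat \<Rightarrow> real"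
  assumes "q \<ge> 1"
  shows "(\<Prod>i<q. (sigma_args \<sigma> q ! i) ^ g i) * \<sigma> 1 ^ g q = (\<Prod>s = 1..q. \<sigma> s ^ (g (q - s) + g (q + 1 - s)))"
proof -
  obtain c where c: "q = Suc c" using assms by (cases q) auto
  have "(\<Prod>i<q. (sigma_args \<sigma> q ! i) ^ g i) = \<sigma> q ^ g 0 * (\<Prod>i<c. (\<sigma> (q - i) * \<sigma> (q - Suc i)) ^ g (Suc i))"
    unfolding c prod.lessThan_Suc_shift by (simp add: sigma_args_def del: upt_Suc)
  also have "\<dots> = (\<sigma> q ^ g 0 * (\<Prod>i<c. \<sigma> (q - Suc i) ^ g (Suc i))) * (\<Prod>i<c. \<sigma> (q - i) ^ g (Suc i))"
    by (simp add: power_mult_distrib prod.distrib mult_ac)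
  also have "\<sigma> q ^ g 0 * (\<Prod>i<c. \<sigma> (q - Suc i) ^ g (Suc i)) = (\<Prod>i<q. \<sigma> (q - i) ^ g i)"
    unfolding c prod.lessThan_Suc_shift by simp
  also have "\<dots> = (\<Prod>s = 1..q. \<sigma> s ^ g (q - s))"
    by (rule prod.reindex_bij_witness[of _ "\<lambda>s. q - s" "\<lambda>i. q - i"]) auto
  finally have "(\<Prod>i<q. (sigma_args \<sigma> q ! i) ^ g i) * \<sigma> 1 ^ g q =
      (\<Prod>s = 1..q. \<sigma> s ^ g (q - s)) * ((\<Prod>i<c. \<sigma> (q - i) ^ g (Suc i)) * \<sigma> 1 ^ g q)"
    by simp
  also have "(\<Prod>i<c. \<sigma> (q - i) ^ g (Suc i)) * \<sigma> 1 ^ g q = (\<Prod>i<q. \<sigma> (q - i) ^ g (Suc i))"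
    unfolding c by simp
  also have "\<dots> = (\<Prod>s = 1..q. \<sigma> s ^ g (q + 1 - s))"
    by (rule prod.reindex_bij_witness[of _ "\<lambda>s. q - s" "\<lambda>i. q - i"]) (auto simp: Suc_diff_le)
  finally show ?thesis by (simp add: power_add prod.distrib)
qed

lemma sum_signs_power: "(\<Sum>x\<in>{-1, 1 :: real}. x ^ e) = (if even e then 2 else 0)"
  by simp

lemma prod_if: "finite A \<Longrightarrow> (\<Prod>s\<in>A. if P s then c else (0 :: real)) = (if \<forall>s\<in>A. P s then c ^ card A else 0)"
  by (induction A rule: finite_induct) auto

text \<open>The sum over one sign vanishes unless its two exponents have equal parity; along the
  chain of neighbours all parities then agree with that of \<open>g q\<close>.\<close>

lemma sum_sigma_args:
  assumes "q \<ge> 1"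
  shows "(\<Sum>\<sigma>\<in>{1..q} \<rightarrow>\<^sub>E {-1, 1 :: real}. (\<Prod>i<q. (sigma_args \<sigma> q ! i) ^ g i) * \<sigma> 1 ^ g q) =
    (if \<forall>i<q. even (g i) = even (g q) then 2 ^ q else 0)"
proof -
  have "(\<Sum>\<sigma>\<in>{1..q} \<rightarrow>\<^sub>E {-1, 1 :: real}. (\<Prod>i<q. (sigma_args \<sigma> q ! i) ^ g i) * \<sigma> 1 ^ g q) =
      (\<Prod>s = 1..q. \<Sum>x\<in>{-1, 1 :: real}. x ^ (g (q - s) + g (q + 1 - s)))"
    unfolding prod_sigma_args[OF assms] by (rule prod_sum_PiE[symmetric]) auto
  also have "\<dots> = (if \<forall>s\<in>{1..q}. even (g (q - s) + g (q + 1 - s)) then 2 ^ q else 0)"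
    unfolding sum_signs_power by (simp add: prod_if)
  also have "(\<forall>s\<in>{1..q}. even (g (q - s) + g (q + 1 - s))) \<longleftrightarrow> (\<forall>i<q. even (g i) = even (g q))"
  proof
    assume H: "\<forall>s\<in>{1..q}. even (g (q - s) + g (q + 1 - s))"
    have ev: "even (g (q - s)) = even (g q)" if "s \<le> q" for s
      using that
    proof (induction s)
      case (Suc s)
      then have "even (g (q - Suc s) + g (q - s))" using H[rule_format, of "Suc s"] by simp
      then show ?case using Suc by auto
    qed simp
    show "\<forall>i<q. even (g i) = even (g q)"
    proof (intro allI impI)
      fix i assume "i < q"
      then show "even (g i) = even (g q)" using ev[of "q - i"] by simp
    qed
  next
    assume H: "\<forall>i<q. even (g i) = even (g q)"
    have ev: "even (g i) = even (g q)" if "i \<le> q" for i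
      using H that by (cases "i = q") auto
    show "\<forall>s\<in>{1..q}. even (g (q - s) + g (q + 1 - s))"
    proof
      fix s assume "s \<in> {1..q}"
      then have "q - s \<le> q" "q + 1 - s \<le> q" by auto
      from this[THEN ev] show "even (g (q - s) + g (q + 1 - s))" by simp
    qed
  qed
  finally show ?thesis .
qed

section \<open>Tuples of equal parity\<close>

lemma nested_sum_even:
  "nested_sum 0 N (map (\<lambda>a n. if even n then 1 / real n ^ a else 0) as) =
     1 / 2 ^ sum_list as * nested_sum 0 (N div 2) (map (\<lambda>a n. 1 / (real n + 0) ^ a) as)"
proof (induction as arbitrary: N)
  case (Cons a as)
  define E where "E n = nested_sum 0 n (map (\<lambda>a n. if even n then 1 / real n ^ a else 0) as)" for n
  define F where "F n = nested_sum 0 n (map (\<lambda>a n. 1 / (real n + 0) ^ a) as)" for n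
  have "(\<Sum>n\<in>{0<..N}. (if even n then 1 / real n ^ a else 0) * E (n - 1)) =
      (\<Sum>n\<in>{n\<in>{0<..N}. even n}. 1 / real n ^ a * E (n - 1))"
    by (intro sum.mono_neutral_cong_right) auto
  also have "\<dots> = (\<Sum>k\<in>{0<..N div 2}. 1 / 2 ^ sum_list (a # as) * (1 / (real k + 0) ^ a * F (k - 1)))"
  proof (rule sum.reindex_bij_witness[of _ "\<lambda>k. 2 * k" "\<lambda>n. n div 2"])
    fix n assume "n \<in> {n\<in>{0<..N}. even n}"
    then obtain k where k: "n = 2 * k" "k > 0" by auto
    then have "(n - 1) div 2 = k - 1" by linarith
    then have "E (n - 1) = 1 / 2 ^ sum_list as * F (k - 1)"
      unfolding E_def F_def Cons.IH by simp
    then show "1 / 2 ^ sum_list (a # as) * (1 / (real (n div 2) + 0) ^ a * F (n div 2 - 1)) = 1 / real n ^ a * E (n - 1)"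
      using k by (simp add: power_add power_mult_distrib)
  qed auto
  finally show ?case by (simp add: E_def F_def sum_distrib_left)
qed simp

text \<open>The substitution is \<open>n = 2 * k - 1\<close>. The shape
  \<open>real n + - 1 / 2\<close>, like \<open>real n + 0\<close> in the even case, is that of
  \<open>nested_sum_tendsto\<close>, with \<open>z = - 1 / 2\<close> and
  \<open>z = 0\<close>.\<close>

lemma nested_sum_odd:
  "nested_sum 0 N (map (\<lambda>a n. if odd n then 1 / real n ^ a else 0) as) =
     1 / 2 ^ sum_list as * nested_sum 0 ((N + 1) div 2) (map (\<lambda>a n. 1 / (real n + - 1 / 2) ^ a) as)"
proof (induction as arbitrary: N)
  case (Cons a as)
  define E where "E n = nested_sum 0 n (map (\<lambda>a n. if odd n then 1 / real n ^ a else 0) as)" for n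
  define F where "F n = nested_sum 0 n (map (\<lambda>a n. 1 / (real n + - 1 / 2) ^ a) as)" for n
  have "(\<Sum>n\<in>{0<..N}. (if odd n then 1 / real n ^ a else 0) * E (n - 1)) =
      (\<Sum>n\<in>{n\<in>{0<..N}. odd n}. 1 / real n ^ a * E (n - 1))"
    by (intro sum.mono_neutral_cong_right) auto
  also have "\<dots> = (\<Sum>k\<in>{0<..(N + 1) div 2}. 1 / 2 ^ sum_list (a # as) * (1 / (real k + - 1 / 2) ^ a * F (k - 1)))"
  proof (rule sum.reindex_bij_witness[of _ "\<lambda>k. 2 * k - 1" "\<lambda>n. (n + 1) div 2"])
    fix n assume "n \<in> {n\<in>{0<..N}. odd n}"
    then obtain k where k: "n = 2 * k + 1" by (auto elim: oddE)
    then have "E (n - 1) = 1 / 2 ^ sum_list as * F k"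
      unfolding E_def F_def Cons.IH by simp
    moreover have "real (k + 1) + - 1 / 2 = real n / 2" using k by simp
    then have "1 / (real (k + 1) + - 1 / 2) ^ a = 2 ^ a * (1 / real n ^ a)"
      by (simp only: power_divide) simp
    moreover have "(n + 1) div 2 = k + 1" using k by simp
    ultimately show "1 / 2 ^ sum_list (a # as) * (1 / (real ((n + 1) div 2) + - 1 / 2) ^ a * F ((n + 1) div 2 - 1)) =
        1 / real n ^ a * E (n - 1)"
      by (simp only: sum_list.Cons power_add) simp
    show "2 * ((n + 1) div 2) - 1 = n" "(n + 1) div 2 \<in> {0<..(N + 1) div 2}"
      using k \<open>n \<in> {n\<in>{0<..N}. odd n}\<close> by auto
  next
    fix k assume "k \<in> {0<..(N + 1) div 2}"
    then have k: "0 < k" "2 * k - 1 \<le> N" by auto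
    then show "(2 * k - 1 + 1) div 2 = k" "2 * k - 1 \<in> {n\<in>{0<..N}. odd n}"
      by auto
  qed
  finally show ?case by (simp add: E_def F_def sum_distrib_left)
qed simp

lemma nested_sum_even_tendsto:
  assumes "admissible (rev as)"
  shows "(\<lambda>N. nested_sum 0 N (map (\<lambda>a n. if even n then 1 / real n ^ a else 0) as)) \<longlonglongrightarrow>
    1 / 2 ^ sum_list as * tail_zeta (rev as) 0"
proof -
  have "filterlim (\<lambda>N. N div 2) sequentially (sequentially :: nat filter)"
    by (rule filterlim_at_top_div_const_nat) simp
  from filterlim_compose[OF nested_sum_tendsto[OF assms, of 0 0] this] show ?thesis
    unfolding nested_sum_even by (intro tendsto_mult_left) simp
qed

lemma nested_sum_odd_tendsto:
  assumes "admissible (rev as)"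
  shows "(\<lambda>N. nested_sum 0 N (map (\<lambda>a n. if odd n then 1 / real n ^ a else 0) as)) \<longlonglongrightarrow>
    1 / 2 ^ sum_list as * tail_zeta (rev as) (- 1 / 2)"
proof -
  have "filterlim (\<lambda>N. (N + 1) div 2) sequentially (sequentially :: nat filter)"
    by (rule filterlim_compose[OF filterlim_at_top_div_const_nat filterlim_add_const_nat_at_top]) simp
  from filterlim_compose[OF nested_sum_tendsto[OF assms, of 0 "- 1 / 2"] this] show ?thesis
    unfolding nested_sum_odd by (intro tendsto_mult_left) simp
qed

lemma sum_sigma_polylog:
  assumes "q \<ge> 1" "length as = q" "admissible (rev as)"
  shows "(\<Sum>\<sigma>\<in>{1..q} \<rightarrow>\<^sub>E {-1, 1 :: real}. multi_polylog as (sigma_args \<sigma> q)) =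
    2 ^ q / 2 ^ sum_list as * tail_zeta (rev as) 0"
proof -
  define S where "S = {1..q} \<rightarrow>\<^sub>E {-1, 1 :: real}"
  have "(\<lambda>N. \<Sum>\<sigma>\<in>S. multi_polylog_trunc as (sigma_args \<sigma> q) N) \<longlonglongrightarrow>
      (\<Sum>\<sigma>\<in>S. multi_polylog as (sigma_args \<sigma> q))"
    using assms sigma_args_bound[OF assms(1), folded S_def]
    by (intro tendsto_sum multi_polylog_tendsto) (auto simp: length_sigma_args)
  moreover have "(\<Sum>\<sigma>\<in>S. multi_polylog_trunc as (sigma_args \<sigma> q) N) =
      2 ^ q * nested_sum 0 N (map (\<lambda>a n. if even n then 1 / real n ^ a else 0) as)" for N
  proof -
    define fs where "fs = map (\<lambda>a n. if even n then 1 / real n ^ a else 0) as"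
    have "(\<Sum>\<sigma>\<in>S. multi_polylog_trunc as (sigma_args \<sigma> q) N) = (\<Sum>ns\<in>decreasing_tuples N q.
        (\<Sum>\<sigma>\<in>S. \<Prod>i<q. (sigma_args \<sigma> q ! i) ^ (ns ! i)) * (\<Prod>i<q. 1 / real (ns ! i) ^ (as ! i)))"
    proof -
      have "(\<Prod>i<q. (sigma_args \<sigma> q ! i) ^ (ns ! i) / real (ns ! i) ^ (as ! i)) =
          (\<Prod>i<q. (sigma_args \<sigma> q ! i) ^ (ns ! i)) * (\<Prod>i<q. 1 / real (ns ! i) ^ (as ! i))" for \<sigma> ns
        unfolding prod.distrib[symmetric] by simp
      then show ?thesis
        unfolding multi_polylog_trunc_def assms(2) sum_distrib_right by (simp only:) (rule sum.swap)
    qed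
    also have "\<dots> = (\<Sum>ns\<in>decreasing_tuples N q. 2 ^ q * (\<Prod>i<q. (fs ! i) (ns ! i)))"
    proof (rule sum.cong[OF refl])
      fix ns :: "nat list"
      \<comment> \<open>The value 0 at \<open>q\<close> stands for the absent last argument and
        forces every entry to be even.\<close>
      define g where "g i = (if i < q then ns ! i else 0)" for i
      have "(\<Sum>\<sigma>\<in>S. \<Prod>i<q. (sigma_args \<sigma> q ! i) ^ (ns ! i)) = (\<Sum>\<sigma>\<in>S. (\<Prod>i<q. (sigma_args \<sigma> q ! i) ^ g i) * \<sigma> 1 ^ g q)"
        by (simp add: g_def)
      also have "\<dots> = (if \<forall>i<q. even (g i) = even (g q) then 2 ^ q else 0)"
        unfolding S_def by (rule sum_sigma_args[OF assms(1)])
      also have "\<dots> = (if \<forall>i<q. even (ns ! i) then 2 ^ q else 0)"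
        by (simp add: g_def)
      finally have eq: "(\<Sum>\<sigma>\<in>S. \<Prod>i<q. (sigma_args \<sigma> q ! i) ^ (ns ! i)) = (if \<forall>i<q. even (ns ! i) then 2 ^ q else 0)" .
      have "(\<Prod>i<q. (fs ! i) (ns ! i)) = (\<Prod>i<q. if even (ns ! i) then 1 / real (ns ! i) ^ (as ! i) else 0)"
        using assms(2) by (intro prod.cong) (auto simp: fs_def)
      also have "\<dots> = (if \<forall>i<q. even (ns ! i) then \<Prod>i<q. 1 / real (ns ! i) ^ (as ! i) else 0)"
        by (auto intro!: prod_zero)
      finally have f: "(\<Prod>i<q. (fs ! i) (ns ! i)) =
          (if \<forall>i<q. even (ns ! i) then \<Prod>i<q. 1 / real (ns ! i) ^ (as ! i) else 0)" .
      show "(\<Sum>\<sigma>\<in>S. \<Prod>i<q. (sigma_args \<sigma> q ! i) ^ (ns ! i)) * (\<Prod>i<q. 1 / real (ns ! i) ^ (as ! i)) =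
          2 ^ q * (\<Prod>i<q. (fs ! i) (ns ! i))"
        unfolding eq f by (simp only: if_distrib[of "\<lambda>c. c * _"] if_distrib[of "\<lambda>c. _ * c"] mult_zero_left mult_zero_right)
    qed
    also have "\<dots> = 2 ^ q * nested_sum 0 N fs"
      using sum_decreasing_tuples[where fs = fs and N = N] assms(2)
      by (simp add: sum_distrib_left[symmetric] fs_def)
    finally show ?thesis unfolding fs_def .
  qed
  moreover have "(\<lambda>N. 2 ^ q * nested_sum 0 N (map (\<lambda>a n. if even n then 1 / real n ^ a else 0) as)) \<longlonglongrightarrow>
      2 ^ q * (1 / 2 ^ sum_list as * tail_zeta (rev as) 0)"
    using assms(3) by (intro tendsto_mult_left nested_sum_even_tendsto)
  ultimately have "(\<Sum>\<sigma>\<in>S. multi_polylog as (sigma_args \<sigma> q)) = 2 ^ q * (1 / 2 ^ sum_list as * tail_zeta (rev as) 0)"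
    by (simp only:) (rule LIMSEQ_unique)
  then show ?thesis by (simp add: S_def)
qed

text \<open>The extra argument ties all parities to that of the last entry, and its minus sign
  counts even tuples positively and odd ones negatively.\<close>

lemma sum_sigma_polylog_minus:
  assumes "q \<ge> 1" "length as = q + 1" "admissible (rev as)"
  shows "(\<Sum>\<sigma>\<in>{1..q} \<rightarrow>\<^sub>E {-1, 1 :: real}. multi_polylog as (sigma_args \<sigma> q @ [- \<sigma> 1])) =
    2 ^ q / 2 ^ sum_list as * (tail_zeta (rev as) 0 - tail_zeta (rev as) (- 1 / 2))"
proof -
  define S where "S = {1..q} \<rightarrow>\<^sub>E {-1, 1 :: real}"
  define x where "x \<sigma> = sigma_args \<sigma> q @ [- \<sigma> 1]" for \<sigma> :: "nat \<Rightarrow> real"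
  have len: "length (sigma_args \<sigma> q) = q" for \<sigma> :: "nat \<Rightarrow> real" using assms(1) by (rule length_sigma_args)
  have x_nth: "x \<sigma> ! i = sigma_args \<sigma> q ! i" if "i < q" for \<sigma> i using that by (simp add: x_def nth_append len)
  have x_q: "x \<sigma> ! q = - \<sigma> 1" for \<sigma> by (simp add: x_def nth_append len)
  have "\<bar>\<sigma> 1\<bar> \<le> 1" if "\<sigma> \<in> S" for \<sigma>
    using that PiE_mem[of \<sigma> "{1..q}" "\<lambda>_. {-1, 1}" 1] assms(1) by (auto simp: S_def)
  with sigma_args_bound[OF assms(1), folded S_def]
  have "(\<lambda>N. \<Sum>\<sigma>\<in>S. multi_polylog_trunc as (x \<sigma>) N) \<longlonglongrightarrow> (\<Sum>\<sigma>\<in>S. multi_polylog as (x \<sigma>))"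
    using assms by (intro tendsto_sum multi_polylog_tendsto) (auto simp: len x_def)
  moreover have "(\<Sum>\<sigma>\<in>S. multi_polylog_trunc as (x \<sigma>) N) =
      2 ^ q * (nested_sum 0 N (map (\<lambda>a n. if even n then 1 / real n ^ a else 0) as)
        - nested_sum 0 N (map (\<lambda>a n. if odd n then 1 / real n ^ a else 0) as))" for N
  proof -
    define fs gs where "fs = map (\<lambda>a n. if even n then 1 / real n ^ a else 0) as"
      and "gs = map (\<lambda>a n. if odd n then 1 / real n ^ a else 0) as"
    have "(\<Sum>\<sigma>\<in>S. multi_polylog_trunc as (x \<sigma>) N) = (\<Sum>ns\<in>decreasing_tuples N (q + 1).
        (\<Sum>\<sigma>\<in>S. \<Prod>i<q + 1. (x \<sigma> ! i) ^ (ns ! i)) * (\<Prod>i<q + 1. 1 / real (ns ! i) ^ (as ! i)))"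
    proof -
      have "(\<Prod>i<q + 1. (x \<sigma> ! i) ^ (ns ! i) / real (ns ! i) ^ (as ! i)) =
          (\<Prod>i<q + 1. (x \<sigma> ! i) ^ (ns ! i)) * (\<Prod>i<q + 1. 1 / real (ns ! i) ^ (as ! i))" for \<sigma> ns
        unfolding prod.distrib[symmetric] by simp
      then show ?thesis
        unfolding multi_polylog_trunc_def assms(2) sum_distrib_right by (simp only:) (rule sum.swap)
    qed
    also have "\<dots> = (\<Sum>ns\<in>decreasing_tuples N (q + 1).
        2 ^ q * ((\<Prod>i<q + 1. (fs ! i) (ns ! i)) - (\<Prod>i<q + 1. (gs ! i) (ns ! i))))"
    proof (rule sum.cong[OF refl])
      fix ns :: "nat list"
      define A where "A = (\<Prod>i<q + 1. 1 / real (ns ! i) ^ (as ! i))"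
      have "(\<Prod>i<q + 1. (x \<sigma> ! i) ^ (ns ! i)) =
          (-1) ^ (ns ! q) * ((\<Prod>i<q. (sigma_args \<sigma> q ! i) ^ (ns ! i)) * \<sigma> 1 ^ (ns ! q))" for \<sigma>
        by (simp add: x_nth x_q power_minus[of "\<sigma> (Suc 0)"])
      then have "(\<Sum>\<sigma>\<in>S. \<Prod>i<q + 1. (x \<sigma> ! i) ^ (ns ! i)) =
          (-1) ^ (ns ! q) * (\<Sum>\<sigma>\<in>S. (\<Prod>i<q. (sigma_args \<sigma> q ! i) ^ (ns ! i)) * \<sigma> 1 ^ (ns ! q))"
        by (simp add: sum_distrib_left)
      also have "(\<Sum>\<sigma>\<in>S. (\<Prod>i<q. (sigma_args \<sigma> q ! i) ^ (ns ! i)) * \<sigma> 1 ^ (ns ! q)) =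
          (if \<forall>i<q. even (ns ! i) = even (ns ! q) then 2 ^ q else 0)"
        unfolding S_def by (rule sum_sigma_args[OF assms(1)])
      finally have eq: "(\<Sum>\<sigma>\<in>S. \<Prod>i<q + 1. (x \<sigma> ! i) ^ (ns ! i)) =
          (-1) ^ (ns ! q) * (if \<forall>i<q. even (ns ! i) = even (ns ! q) then 2 ^ q else 0)" .
      have "(\<Prod>i<q + 1. (fs ! i) (ns ! i)) = (\<Prod>i<q + 1. if even (ns ! i) then 1 / real (ns ! i) ^ (as ! i) else 0)"
        using assms(2) by (intro prod.cong) (auto simp: fs_def)
      also have "\<dots> = (if \<forall>i<q + 1. even (ns ! i) then A else 0)"
        unfolding A_def by (auto intro!: prod_zero prod.cong simp del: prod.lessThan_Suc)
      finally have f: "(\<Prod>i<q + 1. (fs ! i) (ns ! i)) = (if \<forall>i<q + 1. even (ns ! i) then A else 0)" .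
      have "(\<Prod>i<q + 1. (gs ! i) (ns ! i)) = (\<Prod>i<q + 1. if odd (ns ! i) then 1 / real (ns ! i) ^ (as ! i) else 0)"
        using assms(2) by (intro prod.cong) (auto simp: gs_def)
      also have "\<dots> = (if \<forall>i<q + 1. odd (ns ! i) then A else 0)"
        unfolding A_def by (auto intro!: prod_zero prod.cong simp del: prod.lessThan_Suc)
      finally have g: "(\<Prod>i<q + 1. (gs ! i) (ns ! i)) = (if \<forall>i<q + 1. odd (ns ! i) then A else 0)" .
      show "(\<Sum>\<sigma>\<in>S. \<Prod>i<q + 1. (x \<sigma> ! i) ^ (ns ! i)) * (\<Prod>i<q + 1. 1 / real (ns ! i) ^ (as ! i)) =
          2 ^ q * ((\<Prod>i<q + 1. (fs ! i) (ns ! i)) - (\<Prod>i<q + 1. (gs ! i) (ns ! i)))"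
        unfolding eq f g A_def[symmetric] by (cases "even (ns ! q)") (auto simp: less_Suc_eq)
    qed
    also have "\<dots> = 2 ^ q * (nested_sum 0 N fs - nested_sum 0 N gs)"
      using sum_decreasing_tuples[where fs = fs and N = N] sum_decreasing_tuples[where fs = gs and N = N] assms(2)
      by (simp add: sum_distrib_left[symmetric] sum_subtractf fs_def gs_def del: prod.lessThan_Suc)
    finally show ?thesis unfolding fs_def gs_def .
  qed
  moreover have "(\<lambda>N. 2 ^ q * (nested_sum 0 N (map (\<lambda>a n. if even n then 1 / real n ^ a else 0) as)
        - nested_sum 0 N (map (\<lambda>a n. if odd n then 1 / real n ^ a else 0) as))) \<longlonglongrightarrow>
      2 ^ q * (1 / 2 ^ sum_list as * tail_zeta (rev as) 0 - 1 / 2 ^ sum_list as * tail_zeta (rev as) (- 1 / 2))"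
    using assms(3) by (intro tendsto_mult_left tendsto_diff nested_sum_even_tendsto nested_sum_odd_tendsto)
  ultimately have "(\<Sum>\<sigma>\<in>S. multi_polylog as (x \<sigma>)) =
      2 ^ q * (1 / 2 ^ sum_list as * tail_zeta (rev as) 0 - 1 / 2 ^ sum_list as * tail_zeta (rev as) (- 1 / 2))"
    by (simp only:) (rule LIMSEQ_unique)
  then show ?thesis by (simp add: S_def x_def right_diff_distrib)
qed

theorem theorem4p3:
  fixes p r :: nat and m :: "nat \<Rightarrow> nat"
  assumes "p \<ge> 1" and "m 1 \<ge> 1" and "m p \<ge> 1"
  shows
    "(\<Sum>j = 1..p. (-1) ^ (j - 1) * multi_zeta (index_desc m p (j + 1))
        * zeta_B_star (r + 2) (hoffman_dual (index_m m j)))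
     = (\<Sum>j = 1..r. (-1) ^ (r - j) * multi_zeta (index_desc m p 1 @ replicate (r - j) 1)
          * zeta_B_star (j + 1) [])
       + (-1) ^ r * 2 ^ ((\<Sum>i = 1..p. m i) + 1) * ln 2
         * (\<Sum>\<sigma> \<in> {1..p + r} \<rightarrow>\<^sub>E {-1, 1 :: real}.
              multi_polylog (index_desc m p 1 @ replicate r 1) (sigma_args \<sigma> (p + r)))
       + (-1) ^ r * 2 ^ ((\<Sum>i = 1..p. m i) + 1)
         * (\<Sum>\<sigma> \<in> {1..p + r} \<rightarrow>\<^sub>E {-1, 1 :: real}.
              multi_polylog (index_desc m p 1 @ replicate (r + 1) 1)
                (sigma_args \<sigma> (p + r) @ [- \<sigma> 1]))"
proof -
  have sq: "(-1 :: real) ^ n * (-1) ^ n = 1" for n by (simp flip: power_mult_distrib)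
  define M where "M = map (\<lambda>i. m i + 1) [1..<p + 1]"
  define bs where "bs c = replicate c 1 @ M" for c
  define D where "D k = (\<Sum>n. central_weight (Suc n) * dual_star (take k (bs (r + 1))) (Suc n))" for k
  define L where "L = (\<Sum>j = 1..p. (-1) ^ (j - 1) * multi_zeta (index_desc m p (j + 1))
        * zeta_B_star (r + 2) (hoffman_dual (index_m m j)))"
  define R where "R = (\<Sum>j = 1..r. (-1) ^ (r - j) * multi_zeta (index_desc m p 1 @ replicate (r - j) 1)
          * zeta_B_star (j + 1) [])"
  have lenM: "length M = p" by (simp add: M_def)
  have "last M = m p + 1" using assms(1) by (simp add: M_def last_map)
  then have adm: "admissible (bs c)" for c
    using assms by (auto simp: admissible_def bs_def M_def)
  have adm_drop: "admissible (drop k M)" for k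
    using adm[of 0] by (auto simp: admissible_def bs_def dest: in_set_dropD)
  have rev_bs: "rev (bs c) = index_desc m p 1 @ replicate c 1" for c
    by (simp add: bs_def M_def index_desc_def rev_map)
  have sum_bs: "sum_list (rev (bs c)) = (\<Sum>i = 1..p. m i) + p + c" for c
  proof -
    have "sum_list M = (\<Sum>i = 1..p. m i + 1)"
      unfolding M_def by (simp add: interv_sum_list_conv_sum_set_nat atLeastLessThanSuc_atLeastAtMost del: upt_Suc)
    then show ?thesis by (simp add: bs_def sum_Suc sum_list_replicate)
  qed
  have zeta_bs: "multi_zeta (index_desc m p 1 @ replicate c 1) = tail_zeta (bs c) 0" for c
    using multi_zeta_eq[OF adm[of c]] by (simp add: rev_bs)
  have zeta_drop: "tail_zeta (drop j M) 0 = multi_zeta (index_desc m p (j + 1))" for j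
  proof -
    have "rev (drop j M) = index_desc m p (j + 1)"
      by (simp add: M_def index_desc_def drop_map drop_upt del: upt_Suc)
    then show ?thesis using multi_zeta_eq[OF adm_drop[of j]] by simp
  qed
  have D_ones: "D k = zeta_B_star k []" if "k \<le> r + 1" for k
  proof -
    have "take k (bs (r + 1)) = replicate k 1 @ []"
      using that by (simp add: bs_def take_replicate min_absorb1 del: replicate_Suc)
    then show ?thesis
      unfolding D_def zeta_B_star_eq by (simp only: dual_star_replicate_append dual_star.simps star_zeta.simps)
  qed
  have D_dual: "D (r + 1 + i) = zeta_B_star (r + 2) (hoffman_dual (index_m m i))" if "1 \<le> i" "i \<le> p" for i
  proof -
    have "take (r + 1 + i) (bs (r + 1)) = replicate (r + 1) 1 @ map (\<lambda>i. m i + 1) [1..<i + 1]"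
      using that by (simp add: bs_def M_def take_map take_upt del: replicate_Suc upt_Suc)
    moreover have "dual_star (replicate (r + 1) 1 @ map (\<lambda>i. m i + 1) [1..<i + 1]) n =
        star_zeta (hoffman_dual (index_m m i)) n / real n ^ (r + 2)" for n
      unfolding dual_star_replicate_append dual_star_hoffman_dual[of m i, OF assms(2) that(1)] by (simp add: mult_ac)
    ultimately show ?thesis unfolding D_def zeta_B_star_eq by (simp only:)
  qed
  have "zeta_B_star 1 [] = 2 * ln 2"
    using suminf_central_weight_divide unfolding zeta_B_star_eq by simp
  then have D_1: "D 1 = 2 * ln 2" using D_ones[of 1] by simp

  \<comment> \<open>The prefix length \<open>k = 1\<close> yields the logarithm,
    \<open>k = 2, ..., r + 1\<close> yield \<open>R\<close>, and the prefixes reaching into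
    \<open>M\<close> yield \<open>L\<close>.\<close>
  have "tail_zeta (bs (r + 1)) (- 1 / 2) = tail_zeta (bs (r + 1)) 0 +
      (\<Sum>k = 1..r + 1 + p. (-1) ^ (k - 1) * tail_zeta (drop k (bs (r + 1))) 0 * D k)"
    using tail_zeta_minus_half[OF adm[of "r + 1"]] unfolding D_def by (simp add: bs_def lenM)
  also have "(\<Sum>k = 1..r + 1 + p. (-1) ^ (k - 1) * tail_zeta (drop k (bs (r + 1))) 0 * D k) =
      (\<Sum>k = 1..r + 1. (-1) ^ (k - 1) * tail_zeta (drop k (bs (r + 1))) 0 * D k) +
      (\<Sum>k = r + 1 + 1..r + 1 + p. (-1) ^ (k - 1) * tail_zeta (drop k (bs (r + 1))) 0 * D k)"
    by (rule sum.ub_add_nat) simp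
  also have "(\<Sum>k = r + 1 + 1..r + 1 + p. (-1) ^ (k - 1) * tail_zeta (drop k (bs (r + 1))) 0 * D k) =
      - ((-1) ^ r * L)"
  proof -
    have "(\<Sum>k = r + 1 + 1..r + 1 + p. (-1) ^ (k - 1) * tail_zeta (drop k (bs (r + 1))) 0 * D k) =
        (\<Sum>i = 1..p. (-1) ^ (r + i) * tail_zeta (drop i M) 0 * D (r + 1 + i))"
      by (rule sum.reindex_bij_witness[of _ "\<lambda>i. r + 1 + i" "\<lambda>k. k - (r + 1)"]) (auto simp: bs_def simp del: replicate_Suc)
    also have "\<dots> = (\<Sum>i = 1..p. - ((-1) ^ r) * ((-1) ^ (i - 1) * multi_zeta (index_desc m p (i + 1))
        * zeta_B_star (r + 2) (hoffman_dual (index_m m i))))"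
    proof (rule sum.cong[OF refl])
      fix i assume i: "i \<in> {1..p}"
      then have "(-1 :: real) ^ (r + i) = - ((-1) ^ r) * (-1) ^ (i - 1)"
        by (cases i) (auto simp: power_add)
      then show "(-1) ^ (r + i) * tail_zeta (drop i M) 0 * D (r + 1 + i) =
          - ((-1) ^ r) * ((-1) ^ (i - 1) * multi_zeta (index_desc m p (i + 1))
            * zeta_B_star (r + 2) (hoffman_dual (index_m m i)))"
        using i D_dual[of i] zeta_drop[of i] by simp
    qed
    finally show ?thesis unfolding L_def sum_distrib_left[symmetric] by simp
  qed
  also have "(\<Sum>k = 1..r + 1. (-1) ^ (k - 1) * tail_zeta (drop k (bs (r + 1))) 0 * D k) =
      2 * ln 2 * tail_zeta (bs r) 0 + (-1) ^ r * R"
  proof -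
    have drop: "drop k (bs (r + 1)) = bs (r + 1 - k)" if "k \<le> r + 1" for k
      using that by (simp add: bs_def drop_replicate del: replicate_Suc)
    have "(\<Sum>k = 1..r + 1. (-1) ^ (k - 1) * tail_zeta (drop k (bs (r + 1))) 0 * D k) =
        tail_zeta (drop 1 (bs (r + 1))) 0 * D 1 +
        (\<Sum>k = 2..r + 1. (-1) ^ (k - 1) * tail_zeta (drop k (bs (r + 1))) 0 * D k)"
      by (subst sum.atLeast_Suc_atMost) (auto simp: numeral_2_eq_2)
    also have "(\<Sum>k = 2..r + 1. (-1) ^ (k - 1) * tail_zeta (drop k (bs (r + 1))) 0 * D k) =
        (\<Sum>j = 1..r. (-1) ^ r * ((-1) ^ (r - j) * multi_zeta (index_desc m p 1 @ replicate (r - j) 1)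
          * zeta_B_star (j + 1) []))"
    proof (rule sum.reindex_bij_witness[of _ Suc "\<lambda>k. k - 1"])
      fix k assume "k \<in> {2..r + 1}"
      then obtain j where k: "k = j + 1" and "j \<le> r"
        by (intro that[of "k - 1"]) auto
      from \<open>j \<le> r\<close> obtain d where r: "r = j + d"
        using le_Suc_ex by blast
      have "D k = zeta_B_star (j + 1) []" "drop k (bs (r + 1)) = bs d"
        using D_ones[of k] drop[of k] by (simp_all add: k r)
      moreover have "(-1 :: real) ^ r * (-1) ^ d = (-1) ^ j"
        using sq[of d] by (simp add: r power_add mult.assoc)
      moreover have "k - 1 = j" "r - j = d" by (simp_all add: k r)
      ultimately show "(-1) ^ r * ((-1) ^ (r - (k - 1)) * multi_zeta (index_desc m p 1 @ replicate (r - (k - 1)) 1)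
          * zeta_B_star (k - 1 + 1) []) = (-1) ^ (k - 1) * tail_zeta (drop k (bs (r + 1))) 0 * D k"
        by (simp only: zeta_bs mult.assoc[symmetric])
    qed auto
    finally show ?thesis
      unfolding R_def sum_distrib_left D_1 using drop[of 1] by (simp add: mult_ac)
  qed
  finally have main: "tail_zeta (bs (r + 1)) (- 1 / 2) = tail_zeta (bs (r + 1)) 0 +
      (2 * ln 2 * tail_zeta (bs r) 0 + (-1) ^ r * R + - ((-1) ^ r * L))" .

  define W where "W = (\<Sum>i = 1..p. m i)"
  \<comment> \<open>The weight is \<open>W + p + r\<close> against \<open>p + r\<close> signs, so
    the factor \<open>2 ^ (W + 1)\<close> leaves 2, the 2 of \<open>2 * ln 2\<close>; the additional
    entry 1 in \<open>s2\<close> reduces this to 1.\<close>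
  have s1: "2 ^ (W + 1) * (\<Sum>\<sigma> \<in> {1..p + r} \<rightarrow>\<^sub>E {-1, 1 :: real}.
      multi_polylog (index_desc m p 1 @ replicate r 1) (sigma_args \<sigma> (p + r))) = 2 * tail_zeta (bs r) 0"
  proof -
    have "length (rev (bs r)) = p + r" "admissible (rev (rev (bs r)))"
      using adm by (simp_all add: bs_def lenM)
    from sum_sigma_polylog[OF _ this] have
      "(\<Sum>\<sigma> \<in> {1..p + r} \<rightarrow>\<^sub>E {-1, 1 :: real}. multi_polylog (rev (bs r)) (sigma_args \<sigma> (p + r))) =
       2 ^ (p + r) / 2 ^ (W + p + r) * tail_zeta (bs r) 0"
      using assms(1) unfolding sum_bs W_def rev_rev_ident by simp
    then show ?thesis
      unfolding rev_bs[symmetric] by (simp add: power_add)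
  qed
  have s2: "2 ^ (W + 1) * (\<Sum>\<sigma> \<in> {1..p + r} \<rightarrow>\<^sub>E {-1, 1 :: real}.
      multi_polylog (index_desc m p 1 @ replicate (r + 1) 1) (sigma_args \<sigma> (p + r) @ [- \<sigma> 1])) =
      tail_zeta (bs (r + 1)) 0 - tail_zeta (bs (r + 1)) (- 1 / 2)"
  proof -
    have "length (rev (bs (r + 1))) = p + r + 1" "admissible (rev (rev (bs (r + 1))))"
      using adm[of "r + 1"] by (simp_all add: bs_def lenM)
    from sum_sigma_polylog_minus[OF _ this] have
      "(\<Sum>\<sigma> \<in> {1..p + r} \<rightarrow>\<^sub>E {-1, 1 :: real}. multi_polylog (rev (bs (r + 1))) (sigma_args \<sigma> (p + r) @ [- \<sigma> 1])) =
       2 ^ (p + r) / 2 ^ (W + p + (r + 1)) * (tail_zeta (bs (r + 1)) 0 - tail_zeta (bs (r + 1)) (- 1 / 2))"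
      using assms(1) unfolding sum_bs W_def rev_rev_ident by simp
    then show ?thesis
      unfolding rev_bs[symmetric] by (simp add: power_add)
  qed
  have "(-1) ^ r * ((-1) ^ r * L) = (-1) ^ r * (2 * ln 2 * tail_zeta (bs r) 0 +
      (tail_zeta (bs (r + 1)) 0 - tail_zeta (bs (r + 1)) (- 1 / 2)) + (-1) ^ r * R)"
    using main by simp
  then have "L = R + (-1) ^ r * (2 * tail_zeta (bs r) 0) * ln 2 +
      (-1) ^ r * (tail_zeta (bs (r + 1)) 0 - tail_zeta (bs (r + 1)) (- 1 / 2))"
    unfolding distrib_left mult.assoc[symmetric] sq by (simp add: mult_ac)
  then show ?thesis
    unfolding L_def[symmetric] R_def[symmetric] W_def[symmetric] s1[symmetric] s2[symmetric]
    by (simp add: mult_ac)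
qed

end
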